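(* Let $(\mathbb{K},|\cdot|)$ be an algebraically closed normed field, let $f\in\mathbb{K}[z]$ be a polynomial of degree $n\ge 2$, let $N\ge1$ and $1\le p\le\infty$. Suppose $x^{(0)}\in\mathbb{K}^n$ is a vector with pairwise distinct components such that \[ E_f(x^{(0)})<\mathcal{R}=\frac{n(\sqrt[n]{2}-1)\big(a+2-n(\sqrt[n]{2}-1)\big)}{(a+2)\big(a+2+n(a-1)(\sqrt[n]{2}-1)\big)}, \] where $a=(n-1)^{1/q}$. Then $f$ has only simple zeros in $\mathbb{K}$, and the $N$th Weierstrass-type iteration $x^{(k+1)}=T^{(N)}(x^{(k)})$ starting from $x^{(0)}$ is well-defined and converges to a root-vector $\xi$ of $f$ with order of convergence $N+1$, and \[ \|x^{(k)}-\xi\|\preceq\alpha(E_f(x^{(k)}))\,\|W_f(x^{(k)})\| \] for all $k\ge0$ such that $E_f(x^{(k)})\le\mathcal{R}$.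
   Context: $(\mathbb{K},|\cdot|)$ is an algebraically closed normed field and $a_0$ denotes the leading coefficient of $f$. For $1\le p\le\infty$, $\|x\|_p=(\sum_{i=1}^n|x_i|^p)^{1/p}$ (with $\|x\|_\infty=\max_i|x_i|$), and $q\in[1,\infty]$ is the conjugate exponent, $1/p+1/q=1$. For $x\in\mathbb{K}^n$, $\|x\|=(|x_1|,\dots,|x_n|)\in\mathbb{R}^n$, and $\preceq$ is the coordinatewise order on $\mathbb{R}^n$. For $x\in\mathbb{K}^n$, $d(x)=(d_1(x),\dots,d_n(x))$ with $d_i(x)=\min_{j\ne i}|x_i-x_j|$; for $x\in\mathbb{K}^n$ and $y\in\mathbb{R}^n$ with nonzero components, $x/y=(|x_1|/y_1,\dots,|x_n|/y_n)$. A vector $\xi\in\mathbb{K}^n$ is a root-vector of $f$ if $f(z)=a_0\prod_{i=1}^n(z-\xi_i)$ for all $z\in\mathbb{K}$. Weierstrass correction: for $x$ with distinct components, $W_f(x)=(W_1(x),\dots,W_n(x))$, $W_i(x)=f(x_i)/\big(a_0\prod_{j\ne i}(x_i-x_j)\big)$, and $E_f(x)=\|W_f(x)/d(x)\|_p$. Weierstrass-type maps: $T^{(0)}(x)=x$ on $D_0=\mathbb{K}^n$; recursively, $D_{N+1}=\{x\in D_N: x_i\ne T^{(N)}_j(x)\text{ for all }i\ne j\}$ and for $x\in D_{N+1}$, $T^{(N+1)}_i(x)=x_i-\dfrac{f(x_i)}{a_0\prod_{j\ne i}(x_i-T^{(N)}_j(x))}$. The iteration $x^{(k+1)}=T^{(N)}(x^{(k)})$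 is well-defined if $x^{(k)}\in D_N$ for all $k$. $\alpha(t)=\dfrac{2}{1-(a-1)t+\sqrt{(1-(a-1)t)^2-4t}}$. *)

theory Defs
  imports "HOL-Computational_Algebra.Polynomial" "HOL-Library.Extended_Real"
begin

definition absolute_value :: "('a::field \<Rightarrow> real) \<Rightarrow> bool" where
  "absolute_value av \<longleftrightarrow>
     (\<forall>x. av x \<ge> 0) \<and> (\<forall>x. av x = 0 \<longleftrightarrow> x = 0) \<and>
     (\<forall>x y. av (x * y) = av x * av y) \<and> (\<forall>x y. av (x + y) \<le> av x + av y)"

definition alg_closed :: "'a::field itself \<Rightarrow> bool" where
  "alg_closed (_::'a itself) \<longleftrightarrow> (\<forall>q::'a poly. degree q \<ge> 1 \<longrightarrow> (\<exists>z. poly q z = 0))"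

text \<open>Vectors in K^n are functions nat => K, only indices i < n matter.\<close>

definition pnorm :: "ereal \<Rightarrow> nat \<Rightarrow> (nat \<Rightarrow> real) \<Rightarrow> real" where
  "pnorm p n v = (if p = \<infinity> then Max ((\<lambda>i. \<bar>v i\<bar>) ` {..<n})
                  else (\<Sum>i<n. \<bar>v i\<bar> powr real_of_ereal p) powr (1 / real_of_ereal p))"

definition inv_q :: "ereal \<Rightarrow> real" where
  "inv_q p = (if p = \<infinity> then 1 else 1 - 1 / real_of_ereal p)"

definition dvec :: "('a::field \<Rightarrow> real) \<Rightarrow> nat \<Rightarrow> (nat \<Rightarrow> 'a) \<Rightarrow> nat \<Rightarrow> real" where
  "dvec av n x i = Min ((\<lambda>j. av (x i - x j)) ` ({..<n} - {i}))"

definition Wcorr :: "'a::field poly \<Rightarrow> nat \<Rightarrow> (nat \<Rightarrow> 'a) \<Rightarrow> nat \<Rightarrow> 'a" where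
  "Wcorr f n x i = poly f (x i) / (lead_coeff f * (\<Prod>j\<in>{..<n} - {i}. x i - x j))"

definition Ef :: "('a::field \<Rightarrow> real) \<Rightarrow> ereal \<Rightarrow> 'a poly \<Rightarrow> (nat \<Rightarrow> 'a) \<Rightarrow> real" where
  "Ef av p f x = pnorm p (degree f) (\<lambda>i. av (Wcorr f (degree f) x i) / dvec av (degree f) x i)"

fun Tmap :: "'a::field poly \<Rightarrow> nat \<Rightarrow> (nat \<Rightarrow> 'a) \<Rightarrow> nat \<Rightarrow> 'a" where
  "Tmap f 0 x = x"
| "Tmap f (Suc N) x = (\<lambda>i. x i - poly f (x i) /
      (lead_coeff f * (\<Prod>j\<in>{..<degree f} - {i}. x i - Tmap f N x j)))"

fun Dom :: "'a::field poly \<Rightarrow> nat \<Rightarrow> (nat \<Rightarrow> 'a) set" where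
  "Dom f 0 = UNIV"
| "Dom f (Suc N) = {x \<in> Dom f N. \<forall>i<degree f. \<forall>j<degree f. i \<noteq> j \<longrightarrow> x i \<noteq> Tmap f N x j}"

definition alpha_fun :: "real \<Rightarrow> real \<Rightarrow> real" where
  "alpha_fun a t = 2 / (1 - (a - 1) * t + sqrt ((1 - (a - 1) * t)\<^sup>2 - 4 * t))"

definition root_vector :: "'a::field poly \<Rightarrow> (nat \<Rightarrow> 'a) \<Rightarrow> bool" where
  "root_vector f \<xi> \<longleftrightarrow> (\<forall>z. poly f z = lead_coeff f * (\<Prod>i<degree f. z - \<xi> i))"

definition converges_to :: "('a::field \<Rightarrow> real) \<Rightarrow> nat \<Rightarrow> (nat \<Rightarrow> nat \<Rightarrow> 'a) \<Rightarrow> (nat \<Rightarrow> 'a) \<Rightarrow> bool" where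
  "converges_to av n xs \<xi> \<longleftrightarrow>
     (\<forall>i<n. \<forall>\<epsilon>>0. \<exists>K. \<forall>k\<ge>K. av (xs k i - \<xi> i) < \<epsilon>)"

definition err_max :: "('a::field \<Rightarrow> real) \<Rightarrow> nat \<Rightarrow> (nat \<Rightarrow> 'a) \<Rightarrow> (nat \<Rightarrow> 'a) \<Rightarrow> real" where
  "err_max av n x \<xi> = Max ((\<lambda>i. av (x i - \<xi> i)) ` {..<n})"

definition conv_order :: "('a::field \<Rightarrow> real) \<Rightarrow> nat \<Rightarrow> (nat \<Rightarrow> nat \<Rightarrow> 'a) \<Rightarrow> (nat \<Rightarrow> 'a) \<Rightarrow> nat \<Rightarrow> bool" where
  "conv_order av n xs \<xi> r \<longleftrightarrow>
     (\<exists>C\<ge>0. \<forall>k. err_max av n (xs (Suc k)) \<xi> \<le> C * (err_max av n (xs k) \<xi>) ^ r)"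

end

theory Submission
  imports Defs "HOL-Analysis.Convex"
begin

text \<open>
  Put \<open>\<rho> = n (root n 2 - 1) / (a + 2)\<close>; then the bound on \<open>E\<^sub>f\<close> reads
  \<open>R = \<rho> (1 - \<rho>) / (1 + (a - 1) \<rho>)\<close>, and \<open>\<rho> < 1 / (a + 1)\<close> by Bernoulli's inequality.

  Semilocal part: by Lagrange interpolation every root \<open>\<zeta>\<close> of \<open>f\<close> satisfies
  \<open>\<Sum>j. W\<^sub>j / (x\<^sub>j - \<zeta>) = 1\<close>, which forces it into one of the discs
  \<open>\<bar>x\<^sub>i - \<zeta>\<bar> \<le> \<alpha>(E\<^sub>f(x)) \<bar>W\<^sub>i\<bar> \<le> \<rho> d\<^sub>i(x)\<close>. Two roots \<open>\<zeta>, \<eta>\<close> (a multiple root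
  included) also satisfy \<open>\<Sum>j. W\<^sub>j / ((x\<^sub>j - \<zeta>) (x\<^sub>j - \<eta>)) = 0\<close>, so they cannot share a disc.
  Hence the discs and the roots are in bijection, with no appeal to completeness or to a
  continuity argument.

  Local part: if \<open>\<bar>x\<^sub>i - \<xi>\<^sub>i\<bar> / d\<^sub>i(x)\<close> is bounded by \<open>\<kappa> \<rho>\<close> in the \<open>p\<close>-norm, with \<open>\<kappa> \<le> 1\<close>, then
  \<open>\<bar>T\<^sub>i - \<xi>\<^sub>i\<bar> \<le> \<kappa>\<^sup>N B \<bar>x\<^sub>i - \<xi>\<^sub>i\<bar>\<close> for the \<open>N\<close>th map, where \<open>B < 1\<close>. Since \<open>\<kappa>\<close> may be taken
  proportional to the error, this yields order \<open>N + 1\<close>.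
\<close>

subsection \<open>Real inequalities\<close>

text \<open>The only two consequences of a \<open>p\<close>-norm bound by \<open>E\<close> that matter, the second one by Hoelder's
  inequality for \<open>a = (n - 1) powr (1 / q)\<close>.\<close>
definition dominated :: "nat \<Rightarrow> real \<Rightarrow> (nat \<Rightarrow> real) \<Rightarrow> real \<Rightarrow> bool" where
  "dominated n a u E \<longleftrightarrow> (\<forall>i<n. u i \<le> E) \<and> (\<forall>i<n. (\<Sum>j\<in>{..<n} - {i}. u j) \<le> a * E)"

lemma dominatedD:
  assumes "dominated n a u E" "i < n"
  shows "u i \<le> E" "(\<Sum>j\<in>{..<n} - {i}. u j) \<le> a * E"
  using assms by (auto simp: dominated_def)

lemma dominated_mono:
  assumes "dominated n a v E" "\<And>i. i < n \<Longrightarrow> u i \<le> v i"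
  shows "dominated n a u E"
  unfolding dominated_def
proof (intro conjI allI impI)
  fix i assume i: "i < n"
  show "u i \<le> E"
    using assms dominatedD(1)[OF assms(1) i] i by force
  have "(\<Sum>j\<in>{..<n} - {i}. u j) \<le> (\<Sum>j\<in>{..<n} - {i}. v j)"
    by (rule sum_mono) (use assms in auto)
  then show "(\<Sum>j\<in>{..<n} - {i}. u j) \<le> a * E"
    using dominatedD(2)[OF assms(1) i] by linarith
qed

lemma dominated_scale:
  assumes "dominated n a u E" "c \<ge> 0"
  shows "dominated n a (\<lambda>i. c * u i) (c * E)"
  using assms unfolding dominated_def
  by (auto simp: sum_distrib_left[symmetric] mult.left_commute[of a c] intro!: mult_left_mono)

lemma dominated_le:
  assumes "dominated n a u E" "E \<le> E'" "a \<ge> 0"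
  shows "dominated n a u E'"
  using assms unfolding dominated_def by (meson mult_left_mono order_trans)

section \<open>Hoelder estimates for p-norms, AM-GM and convexity of powers\<close>

text \<open>Hoelder's inequality against the constant vector 1, obtained from Jensen's inequality
  for \<open>x powr r\<close> with equal weights.\<close>

lemma sum_le_card_powr_mean:
  fixes v :: "'b \<Rightarrow> real"
  assumes "finite A" "\<And>i. i \<in> A \<Longrightarrow> v i \<ge> 0" "r \<ge> 1"
  shows "(\<Sum>i\<in>A. v i) \<le> real (card A) powr (1 - 1 / r) * (\<Sum>i\<in>A. v i powr r) powr (1 / r)"
proof -
  \<comment> \<open>\<open>powr_convex\<close> speaks of positive arguments only, so zero entries
    are dropped first. Returning to \<open>A\<close> costs nothing because the exponent
    \<open>1 - 1 / r\<close> of the cardinality is nonnegative.\<close>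
  define S where "S = {i\<in>A. v i > 0}"
  have S: "finite S" "S \<subseteq> A" using assms(1) by (auto simp: S_def)
  have sumS: "(\<Sum>i\<in>A. g (v i)) = (\<Sum>i\<in>S. g (v i))" if "g 0 = 0" for g :: "real \<Rightarrow> real"
    by (rule sum.mono_neutral_right) (use that assms(1,2) in \<open>force simp: S_def\<close>)+
  show ?thesis
  proof (cases "S = {}")
    case True
    then show ?thesis using sumS[of "\<lambda>x. x"] by (simp add: sum_nonneg)
  next
    case False
    define m where "m = real (card S)"
    have m: "m > 0" using False S by (simp add: m_def card_gt_0_iff)
    have "(\<Sum>i\<in>S. (1 / m) *\<^sub>R v i) powr r \<le> (\<Sum>i\<in>S. (1 / m) * (v i powr r))"
    proof (rule convex_on_sum)
      show "convex_on {0<..} (\<lambda>x. x powr r)" using assms(3) by (rule powr_convex)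
    qed (use S False m in \<open>auto simp: m_def S_def\<close>)
    then have "((\<Sum>i\<in>S. v i) / m) powr r \<le> (\<Sum>i\<in>S. v i powr r) / m"
      by (simp add: sum_divide_distrib)
    then have "(((\<Sum>i\<in>S. v i) / m) powr r) powr (1 / r) \<le> ((\<Sum>i\<in>S. v i powr r) / m) powr (1 / r)"
      by (rule powr_mono2[rotated 2]) (use assms(3) in auto)
    moreover have nn: "(\<Sum>i\<in>S. v i) \<ge> 0" "(\<Sum>i\<in>S. v i powr r) \<ge> 0"
      by (auto intro!: sum_nonneg simp: S_def)
    ultimately have "(\<Sum>i\<in>S. v i) / m \<le> (\<Sum>i\<in>S. v i powr r) powr (1 / r) / m powr (1 / r)"
      using m assms(3) by (simp add: powr_powr powr_divide)
    then have "(\<Sum>i\<in>S. v i) \<le> (m / m powr (1 / r)) * (\<Sum>i\<in>S. v i powr r) powr (1 / r)"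
      using m by (simp add: field_simps)
    also have "m / m powr (1 / r) = m powr (1 - 1 / r)"
      using m by (simp add: powr_diff)
    also have "m powr (1 - 1 / r) \<le> real (card A) powr (1 - 1 / r)"
      using m assms S by (intro powr_mono2) (auto simp: m_def card_mono)
    finally show ?thesis
      using sumS[of "\<lambda>x. x"] sumS[of "\<lambda>x. x powr r"] by (simp add: mult_right_mono)
  qed
qed

text \<open>The constant counts the \<open>n - 1\<close> entries left after removing one index: for
  finite \<open>p\<close> it is the Hoelder factor, for infinite \<open>p\<close> the number of
  terms.\<close>

lemma dominated_pnorm:
  assumes "1 \<le> p" "n \<ge> 1" "\<And>i. i < n \<Longrightarrow> v i \<ge> 0"
  shows "dominated n ((real n - 1) powr inv_q p) v (pnorm p n v)"
proof (cases "p = \<infinity>")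
  case True
  have *: "v i \<le> pnorm p n v" if "i < n" for i
    using that assms(3)[OF that] True unfolding pnorm_def
    by (auto intro!: Max_ge_iff[THEN iffD2] bexI[of _ "\<bar>v i\<bar>"])
  show ?thesis unfolding dominated_def
  proof (intro conjI allI impI)
    fix i assume i: "i < n"
    show "v i \<le> pnorm p n v" by (rule *[OF i])
    have "(\<Sum>j\<in>{..<n} - {i}. v j) \<le> real (card ({..<n} - {i})) * pnorm p n v"
      using * by (intro sum_bounded_above) auto
    then show "(\<Sum>j\<in>{..<n} - {i}. v j) \<le> (real n - 1) powr inv_q p * pnorm p n v"
      using i assms(2) True by (simp add: inv_q_def)
  qed
next
  case False
  define r where "r = real_of_ereal p"
  have r: "r \<ge> 1" using assms(1) False by (cases p) (auto simp: r_def one_ereal_def)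
  have pn: "pnorm p n v = (\<Sum>i<n. \<bar>v i\<bar> powr r) powr (1 / r)"
    using False by (simp add: pnorm_def r_def)
  show ?thesis unfolding dominated_def
  proof (intro conjI allI impI)
    fix i assume i: "i < n"
    have "\<bar>v i\<bar> powr r \<le> (\<Sum>i<n. \<bar>v i\<bar> powr r)"
      using i by (intro member_le_sum) auto
    then have "(\<bar>v i\<bar> powr r) powr (1 / r) \<le> pnorm p n v"
      unfolding pn using r by (intro powr_mono2) auto
    then show "v i \<le> pnorm p n v" using r by (simp add: powr_powr)
    have "(\<Sum>j\<in>{..<n} - {i}. v j)
        \<le> real (card ({..<n} - {i})) powr (1 - 1 / r) * (\<Sum>j\<in>{..<n} - {i}. v j powr r) powr (1 / r)"
      by (rule sum_le_card_powr_mean) (use assms r in auto)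
    also have "\<dots> \<le> (real n - 1) powr (1 - 1 / r) * pnorm p n v"
    proof (rule mult_mono)
      have "(\<Sum>j\<in>{..<n} - {i}. v j powr r) = (\<Sum>j\<in>{..<n} - {i}. \<bar>v j\<bar> powr r)"
        using assms(3) by (intro sum.cong) auto
      also have "\<dots> \<le> (\<Sum>i<n. \<bar>v i\<bar> powr r)"
        by (intro sum_mono2) auto
      finally show "(\<Sum>j\<in>{..<n} - {i}. v j powr r) powr (1 / r) \<le> pnorm p n v"
        unfolding pn using r by (intro powr_mono2) (auto intro: sum_nonneg)
    qed (use i assms(2) in auto)
    finally show "(\<Sum>j\<in>{..<n} - {i}. v j) \<le> (real n - 1) powr inv_q p * pnorm p n v"
      using False by (simp add: inv_q_def r_def)
  qed
qed

text \<open>AM-GM, stated with an upper bound \<open>s\<close> for the sum so that estimates can be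
  inserted directly.\<close>

lemma prod_le_mean_power:
  fixes v :: "'b \<Rightarrow> real"
  assumes "finite A" "\<And>i. i \<in> A \<Longrightarrow> v i \<ge> 0" "(\<Sum>i\<in>A. v i) \<le> s"
  shows "(\<Prod>i\<in>A. v i) \<le> (s / card A) ^ card A"
proof (cases "A = {}")
  case False
  define m where "m = card A"
  have m: "m > 0" using False assms(1) by (simp add: m_def card_gt_0_iff)
  have "(\<Prod>i\<in>A. v i) powr (1 / m) \<le> (\<Sum>i\<in>A. v i / m)"
    using arith_geom_mean[OF assms(1) False assms(2)] by (simp add: m_def)
  also have "\<dots> \<le> s / m"
    using m assms(3) by (simp add: sum_divide_distrib[symmetric] divide_right_mono)
  finally have "((\<Prod>i\<in>A. v i) powr (1 / m)) ^ m \<le> (s / m) ^ m"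
    by (intro power_mono) auto
  moreover have "((\<Prod>i\<in>A. v i) powr (1 / m)) ^ m = (\<Prod>i\<in>A. v i)"
    using m prod_nonneg[of A v] assms(2) by (cases "(\<Prod>i\<in>A. v i) = 0") (simp_all add: powr_power)
  ultimately show ?thesis by (simp add: m_def)
qed auto

text \<open>A convex function lies below its chord: here t -> (1 + t u)^m on [0, 1]. This later
  pulls a power of \<open>\<kappa>\<close> out of the contraction estimate.\<close>

lemma power_convex_le:
  fixes u \<mu> :: real
  assumes "0 \<le> \<mu>" "\<mu> \<le> 1" "u \<ge> 0"
  shows "(1 + \<mu> * u) ^ m \<le> 1 + \<mu> * ((1 + u) ^ m - 1)"
proof (induction m)
  case (Suc m)
  define P where "P = (1 + u) ^ m"
  have P: "P \<ge> 1" using assms(3) by (simp add: P_def)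
  have "(1 + \<mu> * u) ^ Suc m \<le> (1 + \<mu> * u) * (1 + \<mu> * (P - 1))"
    using Suc assms by (simp add: P_def mult_left_mono)
  also have "\<dots> = 1 + \<mu> * (P - 1) + \<mu> * u + \<mu> * (\<mu> * (u * (P - 1)))" by (simp add: algebra_simps)
  \<comment> \<open>The only loss in the induction is replacing \<open>\<mu> * \<mu>\<close> by
    \<open>\<mu>\<close>.\<close>
  also have "\<dots> \<le> 1 + \<mu> * (P - 1) + \<mu> * u + \<mu> * (1 * (u * (P - 1)))"
    using assms P by (intro add_left_mono mult_left_mono mult_right_mono) auto
  also have "\<dots> = 1 + \<mu> * ((1 + u) ^ Suc m - 1)" by (simp add: P_def algebra_simps)
  finally show ?case .
qed auto

section \<open>The quadratic equation behind alpha\<close>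

text \<open>With \<open>B = 1 - (a - 1) * E\<close>, the number \<open>\<alpha> * E\<close> is the
  smaller root of t^2 - B t + E = 0, which is the equation t (1 - t - a E) = E (1 - t). Assumption
  \<open>ER\<close> says that \<open>\<rho>\<close> lies between the two roots, and the larger root
  exceeds 1/2.\<close>

lemma alpha_fun_bounds:
  fixes a \<rho> E :: real
  assumes a: "a \<ge> 1" and \<rho>: "0 < \<rho>" "\<rho> * (a + 1) < 1" and E: "0 \<le> E"
    and ER: "E * (1 + (a - 1) * \<rho>) \<le> \<rho> * (1 - \<rho>)"
  defines "\<alpha> \<equiv> alpha_fun a E"
  shows "2 * (1 + a) * E < 1" "\<alpha> > 0" "\<alpha> * E \<le> \<rho>"
    "\<alpha> * (1 - \<alpha> * E - a * E) = 1 - \<alpha> * E"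
    "\<And>t. t < 1/2 \<Longrightarrow> t * (1 - t - a * E) \<le> E * (1 - t) \<Longrightarrow> t \<le> \<alpha> * E"
proof -
  define B where "B = 1 - (a - 1) * E"
  define s where "s = sqrt (B\<^sup>2 - 4 * E)"
  have \<rho>2: "\<rho> < 1/2"
  proof -
    have "\<rho> * 2 \<le> \<rho> * (a + 1)" using a \<rho> by (intro mult_left_mono) auto
    then show ?thesis using \<rho> by linarith
  qed
  show E2: "2 * (1 + a) * E < 1"
  proof -
    have pos: "1 + (a - 1) * \<rho> > 0" using a \<rho> by (simp add: add_pos_nonneg)
    have "2 * (1 + a) * (E * (1 + (a - 1) * \<rho>)) \<le> 2 * (1 + a) * (\<rho> * (1 - \<rho>))"
      using a ER by (intro mult_left_mono) auto
    also have "\<dots> < 1 + (a - 1) * \<rho>"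
    proof -
      \<comment> \<open>The right side minus the left side of the claim factors as this
        product.\<close>
      have "(1 - 2 * \<rho>) * (1 - \<rho> * (a + 1)) > 0" using \<rho>2 \<rho> by simp
      then show ?thesis by (simp add: algebra_simps power2_eq_square)
    qed
    finally have "(2 * (1 + a) * E) * (1 + (a - 1) * \<rho>) < 1 * (1 + (a - 1) * \<rho>)"
      by (simp add: algebra_simps)
    then show ?thesis using pos mult_less_cancel_right_pos by blast
  qed
  have aE: "2 * (a - 1) * E + 4 * E < 1" using E2 by (simp add: algebra_simps)
  have aE0: "(a - 1) * E \<ge> 0" using a E by simp
  have B: "B > 1/2" "B \<le> 1" using aE aE0 E unfolding B_def by linarith+
  \<comment> \<open>This is \<open>ER\<close> after completing the square; in particular the
    discriminant is nonnegative.\<close>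
  have q\<rho>: "(2 * \<rho> - B)\<^sup>2 \<le> B\<^sup>2 - 4 * E"
    using ER unfolding B_def by (simp add: power2_eq_square algebra_simps)
  then have disc: "B\<^sup>2 - 4 * E \<ge> 0" by (meson order_trans zero_le_power2)
  have s: "s \<ge> 0" "s\<^sup>2 = B\<^sup>2 - 4 * E" using disc by (auto simp: s_def)
  have \<alpha>: "\<alpha> = 2 / (B + s)" by (simp add: \<alpha>_def alpha_fun_def B_def s_def)
  have Bs: "B + s > 0" using B s by simp
  show "\<alpha> > 0" using Bs by (simp add: \<alpha>)
  have \<alpha>E: "\<alpha> * E = (B - s) / 2"
  proof -
    have "4 * E = (B + s) * (B - s)" using s(2) by (simp add: power2_eq_square algebra_simps)
    then show ?thesis using Bs by (simp add: \<alpha> field_simps)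
  qed
  have "\<bar>2 * \<rho> - B\<bar> \<le> s"
    using q\<rho> s by (metis abs_le_square_iff abs_of_nonneg)
  then have "B - s \<le> 2 * \<rho>" by linarith
  then show "\<alpha> * E \<le> \<rho>" unfolding \<alpha>E by simp
  have "\<alpha> * (B - \<alpha> * E) = 1" using Bs unfolding \<alpha>E by (simp add: \<alpha> field_simps)
  then show "\<alpha> * (1 - \<alpha> * E - a * E) = 1 - \<alpha> * E" unfolding B_def by (simp add: algebra_simps)
  fix t :: real assume t: "t < 1/2" "t * (1 - t - a * E) \<le> E * (1 - t)"
  \<comment> \<open>The larger root \<open>(B + s) / 2\<close> is above 1/2. Hence
    \<open>t < 1/2\<close> leaves only the range below the smaller root.\<close>
  have "(1 - B)\<^sup>2 < s\<^sup>2" using aE unfolding s(2) B_def by (simp add: power2_eq_square algebra_simps)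
  then have "1 - B < s" using s(1) by (rule power2_less_imp_less)
  then have "\<bar>2 * t - B\<bar> < s \<or> 2 * t - B \<le> - s" using t B by linarith
  moreover have "s\<^sup>2 \<le> (2 * t - B)\<^sup>2"
    using t(2) unfolding s(2) B_def by (simp add: power2_eq_square algebra_simps)
  then have "s \<le> \<bar>2 * t - B\<bar>" using s(1) by (metis abs_le_square_iff abs_of_nonneg)
  ultimately have "2 * t - B \<le> - s" by linarith
  then show "t \<le> \<alpha> * E" unfolding \<alpha>E by simp
qed

subsection \<open>Interpolation and factorization\<close>

text \<open>Compare the coefficients of z^(n-1) in \<open>g\<close> and in its Lagrange form: each
  basis polynomial \<open>P j\<close> is monic of degree \<open>n - 1\<close>, so the latter is the
  sum of the weights \<open>c j\<close>.\<close>

lemma lagrange_sum_eq_coeff: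
  fixes x :: "nat \<Rightarrow> 'a::field"
  assumes "inj_on x {..<n}" "degree g < n"
  shows "(\<Sum>j<n. poly g (x j) / (\<Prod>m\<in>{..<n} - {j}. x j - x m)) = coeff g (n - 1)"
proof -
  define P where "P j = (\<Prod>m\<in>{..<n} - {j}. [:- x m, 1:])" for j
  define c where "c j = poly g (x j) / (\<Prod>m\<in>{..<n} - {j}. x j - x m)" for j
  define L where "L = (\<Sum>j<n. smult (c j) (P j))"
  have degP: "degree (P j) = n - 1" if "j < n" for j
    using that unfolding P_def by (subst degree_prod_sum_eq) auto
  have coeffP: "coeff (P j) (n - 1) = 1" if "j < n" for j
  proof -
    have "lead_coeff (P j) = 1" unfolding P_def by (subst lead_coeff_prod) simp
    then show ?thesis by (simp add: degP[OF that])
  qed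
  have "degree L \<le> n - 1"
    unfolding L_def by (rule degree_sum_le) (auto simp: degP intro: order.trans[OF degree_smult_le])
  then have degL: "degree L < n" using assms(2) by linarith
  have "g = L"
  proof (rule poly_eqI_degree[of "x ` {..<n}"])
    fix z assume "z \<in> x ` {..<n}"
    then obtain i where i: "i < n" "z = x i" by auto
    have P0: "poly (P j) (x i) = 0" if "j \<noteq> i" for j
      using that i unfolding P_def poly_prod by (intro prod_zero) auto
    have Pi: "poly (P i) (x i) = (\<Prod>m\<in>{..<n} - {i}. x i - x m)" by (simp add: P_def poly_prod)
    have nz: "(\<Prod>m\<in>{..<n} - {i}. x i - x m) \<noteq> 0"
      using assms(1) i by (auto simp: inj_on_def)
    have "poly L (x i) = (\<Sum>j<n. c j * poly (P j) (x i))" by (simp add: L_def poly_sum)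
    also have "\<dots> = (\<Sum>j\<in>{i}. c j * poly (P j) (x i))"
      using i P0 by (intro sum.mono_neutral_right) auto
    also have "\<dots> = poly g (x i)" using nz by (simp add: Pi c_def)
    finally show "poly g z = poly L z" using i by simp
  qed (use degL assms card_image[OF assms(1)] in auto)
  then have "coeff g (n - 1) = (\<Sum>j<n. c j * coeff (P j) (n - 1))"
    by (simp add: L_def coeff_sum)
  also have "\<dots> = (\<Sum>j<n. c j)" using coeffP by simp
  finally show ?thesis by (simp add: c_def)
qed

lemma alg_closed_splits:
  fixes f :: "'a::field poly"
  assumes "alg_closed TYPE('a)"
  shows "\<exists>\<zeta>. f = smult (lead_coeff f) (\<Prod>i<degree f. [:- \<zeta> i, 1:])"
proof (induction "degree f" arbitrary: f)
  case 0
  then obtain c where "f = [:c:]" by (metis degree_eq_zeroE)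
  then show ?case by simp
next
  case (Suc d)
  have "1 \<le> degree f" using Suc(2) by simp
  then obtain z where "poly f z = 0"
    using assms unfolding alg_closed_def by blast
  then obtain q where f: "f = [:- z, 1:] * q" by (auto simp: poly_eq_0_iff_dvd dvd_def)
  have q0: "q \<noteq> 0" using Suc(2) f by auto
  have deg: "degree f = Suc (degree q)" using q0 unfolding f by (subst degree_mult_eq) auto
  obtain \<zeta> where \<zeta>: "q = smult (lead_coeff q) (\<Prod>i<degree q. [:- \<zeta> i, 1:])"
    using Suc(1)[of q] Suc(2) deg by auto
  have lc: "lead_coeff f = lead_coeff q" unfolding f lead_coeff_mult by simp
  \<comment> \<open>The root split off takes the first free index, so the product over the smaller
    range is unchanged.\<close>
  define \<xi> where "\<xi> = \<zeta>(degree q := z)"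
  have "(\<Prod>i<Suc (degree q). [:- \<xi> i, 1:]) = (\<Prod>i<degree q. [:- \<zeta> i, 1:]) * [:- z, 1:]"
    by (simp add: \<xi>_def)
  then have "smult (lead_coeff f) (\<Prod>i<degree f. [:- \<xi> i, 1:]) =
      smult (lead_coeff q) (\<Prod>i<degree q. [:- \<zeta> i, 1:]) * [:- z, 1:]"
    unfolding lc by (simp only: deg mult_smult_left)
  also have "\<dots> = f" unfolding \<zeta>[symmetric] f by (rule mult.commute)
  finally show ?case by metis
qed

subsection \<open>Absolute values\<close>

locale abs_valued_field =
  fixes av :: "'a::field \<Rightarrow> real"
  assumes absolute_value: "absolute_value av"
begin

lemma av_nonneg [simp]: "av x \<ge> 0"
  and av_eq_0_iff [simp]: "av x = 0 \<longleftrightarrow> x = 0"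
  and av_mult: "av (x * y) = av x * av y"
  and av_add_le: "av (x + y) \<le> av x + av y"
  using absolute_value by (auto simp: absolute_value_def)

lemma av_0 [simp]: "av 0 = 0" by simp

lemma av_pos_iff [simp]: "av x > 0 \<longleftrightarrow> x \<noteq> 0"
  using av_nonneg[of x] av_eq_0_iff[of x] by linarith

lemma av_1 [simp]: "av 1 = 1"
  using av_mult[of 1 1] by simp

lemma av_minus [simp]: "av (- x) = av x"
proof -
  have "av (- 1) * av (- 1) = 1" using av_mult[of "- 1" "- 1"] by simp
  then have "(av (- 1))\<^sup>2 = 1" by (simp add: power2_eq_square)
  then have "av (- 1) = 1" by (metis av_nonneg abs_of_nonneg real_sqrt_abs real_sqrt_one)
  then show ?thesis using av_mult[of "- 1" x] by simp
qed

lemma av_diff_commute: "av (x - y) = av (y - x)"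
  using av_minus[of "x - y"] by simp

lemma av_triangle: "av (x - z) \<le> av (x - y) + av (y - z)"
  using av_add_le[of "x - y" "y - z"] by simp

lemma av_divide: "av (x / y) = av x / av y"
proof (cases "y = 0")
  case False
  then have "av x = av (x / y) * av y" using av_mult[of "x / y" y] by simp
  then show ?thesis using False by simp
qed simp

lemma av_sum_le: "av (\<Sum>i\<in>A. g i) \<le> (\<Sum>i\<in>A. av (g i))"
proof (induction A rule: infinite_finite_induct)
  case (insert x A)
  then show ?case using av_add_le[of "g x" "\<Sum>i\<in>A. g i"] by simp
qed auto

text \<open>Expanding the product and cancelling 1 leaves monomials in the \<open>u i\<close>, each
  of which is replaced by its absolute value.\<close>

lemma av_prod_diff_one_le:
  assumes "finite A"
  shows "av ((\<Prod>i\<in>A. 1 + u i) - 1) \<le> (\<Prod>i\<in>A. 1 + av (u i)) - 1"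
  using assms
proof (induction A)
  case (insert x A)
  define P where "P = (\<Prod>i\<in>A. 1 + u i)"
  define Q where "Q = (\<Prod>i\<in>A. 1 + av (u i))"
  have IH: "av (P - 1) \<le> Q - 1" using insert by (simp add: P_def Q_def)
  have eq: "(1 + u x) * P - 1 = (P - 1) + u x * (P - 1) + u x" by (simp add: algebra_simps)
  have "av ((1 + u x) * P - 1) \<le> av (P - 1) + av (u x) * av (P - 1) + av (u x)"
    unfolding eq av_mult[symmetric] by (meson add_mono av_add_le order.refl order.trans)
  also have "\<dots> \<le> (Q - 1) + av (u x) * (Q - 1) + av (u x)"
    using IH by (intro add_mono mult_left_mono) auto
  also have "\<dots> = (1 + av (u x)) * Q - 1" by (simp add: algebra_simps)
  finally show ?case using insert by (simp add: P_def Q_def)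
qed simp

section \<open>Minimal distances between components\<close>

lemma dvec_le:
  assumes "j < n" "j \<noteq> i"
  shows "dvec av n x i \<le> av (x i - x j)"
  unfolding dvec_def using assms by (intro Min_le) auto

lemma dvec_le':
  assumes "j < n" "j \<noteq> i"
  shows "dvec av n x i \<le> av (x j - x i)"
  using dvec_le[OF assms, of x] by (simp add: av_diff_commute)

lemma dvec_ge:
  assumes "n \<ge> 2" "\<And>j. j < n \<Longrightarrow> j \<noteq> i \<Longrightarrow> c \<le> av (x i - x j)"
  shows "c \<le> dvec av n x i"
proof -
  \<comment> \<open>An index other than \<open>i\<close> exists because \<open>n \<ge> 2\<close>, so
    the minimum is taken over a nonempty set.\<close>
  have "(if i = 0 then 1 else 0) \<in> {..<n} - {i}" using assms(1) by auto
  then have "{..<n} - {i} \<noteq> {}" by blast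
  then show ?thesis unfolding dvec_def using assms(2) by (intro Min.boundedI) auto
qed

lemma dvec_pos:
  assumes "n \<ge> 2" "inj_on x {..<n}" "i < n"
  shows "dvec av n x i > 0"
proof -
  have "(if i = 0 then 1 else 0) \<in> {..<n} - {i}" using assms(1) by auto
  then have "{..<n} - {i} \<noteq> {}" by blast
  then show ?thesis unfolding dvec_def using assms(2,3)
    by (subst Min_gr_iff) (auto simp: inj_on_def)
qed

end

subsection \<open>Localization of the roots\<close>

text \<open>A Lagrange weight: the monic polynomial with roots \<open>\<zeta> m\<close>, m in
  \<open>A\<close>, at \<open>x j\<close>, over the derivative of the node polynomial there. The
  full index set gives the Weierstrass correction; removing an index divides it formally by a root
  difference, even where that difference is zero.\<close>

definition node_quotient :: "(nat \<Rightarrow> 'a::field) \<Rightarrow> (nat \<Rightarrow> 'a) \<Rightarrow> nat \<Rightarrow> nat set \<Rightarrow> nat \<Rightarrow> 'a" where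
  "node_quotient \<zeta> x n A j = (\<Prod>m\<in>A. x j - \<zeta> m) / (\<Prod>m\<in>{..<n} - {j}. x j - x m)"

lemma node_quotient_insert:
  assumes "finite A" "k \<notin> A"
  shows "node_quotient \<zeta> x n (insert k A) j = (x j - \<zeta> k) * node_quotient \<zeta> x n A j"
  using assms by (simp add: node_quotient_def)

text \<open>The coefficient identity for a monic polynomial of degree \<open>card A\<close>. It is
  applied with one index removed (sum 1) and with two removed (sum 0).\<close>

lemma sum_node_quotient:
  assumes "inj_on x {..<n}" "finite A" "card A < n"
  shows "(\<Sum>j<n. node_quotient \<zeta> x n A j) = (if card A = n - 1 then 1 else 0)"
proof -
  define g where "g = (\<Prod>m\<in>A. [:- \<zeta> m, 1:])"
  have deg: "degree g = card A" unfolding g_def by (subst degree_prod_sum_eq) auto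
  have "lead_coeff g = 1" unfolding g_def by (subst lead_coeff_prod) simp
  then have "coeff g (card A) = 1" by (simp add: deg)
  moreover have "coeff g (n - 1) = 0" if "card A \<noteq> n - 1"
    using that assms(3) deg by (intro coeff_eq_0) auto
  moreover have "(\<Sum>j<n. node_quotient \<zeta> x n A j) = coeff g (n - 1)"
    using lagrange_sum_eq_coeff[OF assms(1), of g] assms(3) deg
    by (simp add: node_quotient_def g_def poly_prod)
  ultimately show ?thesis by auto
qed

lemma Wcorr_eq_node_quotient:
  assumes "f = smult c (\<Prod>i<n. [:- \<zeta> i, 1:])" "c \<noteq> 0"
  shows "Wcorr f n x j = node_quotient \<zeta> x n {..<n} j"
proof -
  have "lead_coeff f = c" unfolding assms(1) lead_coeff_smult lead_coeff_prod by simp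
  then show ?thesis using assms by (simp add: Wcorr_def node_quotient_def poly_prod)
qed

context abs_valued_field
begin

text \<open>The node is the one minimizing \<open>\<bar>x\<^sub>i - \<zeta>\<^sub>k\<bar> / d\<^sub>i(x)\<close>. Since \<open>W\<^sub>j = (x\<^sub>j - \<zeta>\<^sub>k) G\<^sub>j\<close> with \<open>\<Sum>j. G\<^sub>j = 1\<close>,
  no case distinction is needed when \<open>\<zeta>\<^sub>k\<close> is one of the nodes.\<close>
lemma root_near_node:
  fixes x \<zeta> :: "nat \<Rightarrow> 'a"
  assumes n: "n \<ge> 2" and x: "inj_on x {..<n}" and c: "c \<noteq> 0"
    and f: "f = smult c (\<Prod>i<n. [:- \<zeta> i, 1:])"
    and a: "a \<ge> 1" and \<rho>: "0 < \<rho>" "\<rho> * (a + 1) < 1"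
    and E: "dominated n a (\<lambda>i. av (Wcorr f n x i) / dvec av n x i) E"
    and ER: "E * (1 + (a - 1) * \<rho>) \<le> \<rho> * (1 - \<rho>)"
    and k: "k < n"
  shows "\<exists>i<n. av (x i - \<zeta> k) \<le> alpha_fun a E * av (Wcorr f n x i)"
proof -
  define W where "W i = Wcorr f n x i" for i
  define d where "d i = dvec av n x i" for i
  define e where "e i = av (W i) / d i" for i
  define G where "G j = node_quotient \<zeta> x n ({..<n} - {k}) j" for j
  define t where "t i = av (x i - \<zeta> k) / d i" for i
  define \<alpha> where "\<alpha> = alpha_fun a E"
  have d: "d i > 0" if "i < n" for i using dvec_pos[OF n x that] by (simp add: d_def)
  have e0: "e i \<ge> 0" if "i < n" for i using d[OF that] by (simp add: e_def)
  have dom: "dominated n a e E" using E by (simp add: e_def[abs_def] W_def d_def)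
  have eE: "e i \<le> E" "(\<Sum>j\<in>{..<n} - {i}. e j) \<le> a * E" if "i < n" for i
    using dominatedD[OF dom that] by auto
  have "E \<ge> 0" using eE(1)[OF k] e0[OF k] by linarith
  note al = alpha_fun_bounds[OF a \<rho> this ER, folded \<alpha>_def]
  have W: "W j = (x j - \<zeta> k) * G j" for j
    using Wcorr_eq_node_quotient[OF f c, of x j] k
      node_quotient_insert[of "{..<n} - {k}" k \<zeta> x n j]
    by (simp add: W_def G_def insert_absorb)
  have "(\<Sum>j<n. G j) = 1"
    unfolding G_def using sum_node_quotient[OF x, of "{..<n} - {k}" \<zeta>] k by simp
  then have G1: "1 \<le> (\<Sum>j<n. av (G j))" using av_sum_le[of G "{..<n}"] by simp
  obtain i where i: "i < n" "\<And>j. j < n \<Longrightarrow> t i \<le> t j"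
  proof -
    have "finite (t ` {..<n})" "t ` {..<n} \<noteq> {}" using k by auto
    from Min_in[OF this] obtain i where "i < n" "t i = Min (t ` {..<n})" by auto
    then show ?thesis using that by (metis Min_le \<open>finite (t ` {..<n})\<close> imageI lessThan_iff)
  qed
  have t0: "t i \<ge> 0" using d[OF i(1)] by (simp add: t_def)
  have ti: "av (x i - \<zeta> k) = t i * d i" using d[OF i(1)] by (simp add: t_def)
  \<comment> \<open>A node at distance at least \<open>b * d j\<close> from the root has a small
    weight, since \<open>W j = (x j - \<zeta> k) * G j\<close>.\<close>
  have G_le: "av (G j) \<le> e j / b" if "j < n" "b > 0" "b * d j \<le> av (x j - \<zeta> k)" for j b
  proof -
    have "b * d j * av (G j) \<le> av (W j)"
      unfolding W av_mult using that(3) by (intro mult_right_mono) auto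
    then show ?thesis using that(2) d[OF that(1)] by (simp add: e_def field_simps)
  qed
  \<comment> \<open>Otherwise every \<open>t j\<close> is at least 1/2, so the weights sum to at
    most 2 (1 + a) E < 1 in absolute value, against \<open>G1\<close>.\<close>
  have t_small: "t i < 1 / 2"
  proof (rule ccontr)
    assume "\<not> t i < 1 / 2"
    have "av (G j) \<le> e j / (1 / 2)" if "j < n" for j
    proof (rule G_le[OF that])
      have "1 / 2 \<le> t j" using i(2)[OF that] \<open>\<not> t i < 1 / 2\<close> by linarith
      then have "1 / 2 * d j \<le> t j * d j" using d[OF that] by (intro mult_right_mono) auto
      then show "1 / 2 * d j \<le> av (x j - \<zeta> k)" using d[OF that] by (simp add: t_def)
    qed simp
    then have "(\<Sum>j<n. av (G j)) \<le> (\<Sum>j<n. 2 * e j)" by (intro sum_mono) (auto simp: mult.commute)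
    also have "\<dots> = 2 * (e i + (\<Sum>j\<in>{..<n} - {i}. e j))"
      using i(1) by (simp add: sum_distrib_left[symmetric] sum.remove)
    also have "\<dots> \<le> 2 * (E + a * E)" using eE[OF i(1)] by simp
    finally show False using G1 al(1) by (simp add: algebra_simps)
  qed
  define S where "S = (\<Sum>j\<in>{..<n} - {i}. av (G j))"
  \<comment> \<open>By the triangle inequality, every other node stays at distance at least
    \<open>(1 - t i) * d j\<close> from the root.\<close>
  have "S \<le> (\<Sum>j\<in>{..<n} - {i}. e j / (1 - t i))"
    unfolding S_def
  proof (rule sum_mono)
    fix j assume "j \<in> {..<n} - {i}"
    then have j: "j < n" "j \<noteq> i" by auto
    have "d i \<le> av (x i - x j)" "d j \<le> av (x i - x j)"
      using dvec_le[of j n i x] dvec_le'[of i n j x] i j by (auto simp: d_def)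
    moreover have "t i * d i \<le> t i * av (x i - x j)"
      using calculation t0 by (intro mult_left_mono) auto
    moreover have "(1 - t i) * d j \<le> (1 - t i) * av (x i - x j)"
      using calculation t_small by (intro mult_left_mono) auto
    moreover have "av (x i - x j) \<le> av (x i - \<zeta> k) + av (x j - \<zeta> k)"
      using av_triangle[of "x i" "x j" "\<zeta> k"] by (simp add: av_diff_commute)
    ultimately have "(1 - t i) * d j \<le> av (x j - \<zeta> k)" unfolding ti by (simp add: algebra_simps)
    then show "av (G j) \<le> e j / (1 - t i)" using t_small j by (intro G_le) auto
  qed
  also have "\<dots> \<le> a * E / (1 - t i)"
    using eE(2)[OF i(1)] t_small by (simp add: sum_divide_distrib[symmetric] divide_right_mono)
  finally have "1 - a * E / (1 - t i) \<le> av (G i)"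
    using G1 i(1) by (simp add: S_def sum.remove)
  then have "av (x i - \<zeta> k) * (1 - a * E / (1 - t i)) \<le> av (W i)"
    unfolding W av_mult by (rule mult_left_mono) simp
  \<comment> \<open>\<open>key\<close> is used twice: divided by \<open>d i\<close> it is the
    quadratic inequality that gives \<open>t i \<le> \<alpha> * E\<close>; then, with this bound on
    \<open>t i\<close>, it yields the claim.\<close>
  then have key: "av (x i - \<zeta> k) * (1 - t i - a * E) \<le> av (W i) * (1 - t i)"
    using t_small by (simp add: field_simps)
  moreover have "av (W i) = e i * d i" using d[OF i(1)] by (simp add: e_def)
  ultimately have "(t i * (1 - t i - a * E)) * d i \<le> (e i * (1 - t i)) * d i"
    unfolding ti by (simp only: mult.assoc mult.commute[of "d i"])
  then have "t i * (1 - t i - a * E) \<le> e i * (1 - t i)" using d[OF i(1)] by simp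
  also have "\<dots> \<le> E * (1 - t i)" using eE(1)[OF i(1)] t_small by (intro mult_right_mono) auto
  finally have t\<alpha>: "t i \<le> \<alpha> * E" by (rule al(5)[OF t_small])
  \<comment> \<open>Equality holds at \<open>t i = \<alpha> * E\<close>; since
    \<open>\<alpha> \<ge> 1\<close>, left minus right does not increase with
    \<open>t i\<close>.\<close>
  have "\<alpha> * (1 - t i - a * E) \<ge> 1 - t i"
  proof -
    have "\<alpha> \<ge> 1"
    proof -
      have "1 - \<alpha> * E - a * E \<le> 1 - \<alpha> * E" using \<open>E \<ge> 0\<close> a by simp
      then have "\<alpha> * (1 - \<alpha> * E - a * E) \<le> \<alpha> * (1 - \<alpha> * E)"
        using al(2) by (intro mult_left_mono) auto
      then have "1 * (1 - \<alpha> * E) \<le> \<alpha> * (1 - \<alpha> * E)" using al(4) by simp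
      moreover have "1 - \<alpha> * E > 0"
      proof -
        have "\<rho> * 1 \<le> \<rho> * (a + 1)" using a \<rho>(1) by (intro mult_left_mono) auto
        then show ?thesis using al(3) \<rho>(2) by linarith
      qed
      ultimately show ?thesis by (rule mult_right_le_imp_le)
    qed
    then have "1 * (\<alpha> * E - t i) \<le> \<alpha> * (\<alpha> * E - t i)" using t\<alpha> by (intro mult_right_mono) auto
    then show ?thesis using al(4) by (simp add: algebra_simps)
  qed
  then have "av (x i - \<zeta> k) * (1 - t i) \<le> av (x i - \<zeta> k) * (\<alpha> * (1 - t i - a * E))"
    by (rule mult_left_mono) simp
  also have "\<dots> \<le> \<alpha> * (av (W i) * (1 - t i))"
    using mult_left_mono[OF key, of \<alpha>] al(2) by (simp add: mult.left_commute)
  finally have "av (x i - \<zeta> k) * (1 - t i) \<le> (\<alpha> * av (W i)) * (1 - t i)" by (simp add: mult.assoc)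
  then have "av (x i - \<zeta> k) \<le> \<alpha> * av (W i)" using t_small by simp
  then show ?thesis using i(1) by (auto simp: \<alpha>_def W_def)
qed

text \<open>Two nearby roots make the weight \<open>G i\<close> too small. The \<open>H j\<close>
  sum to 0, so \<open>H i\<close> is controlled by the other nodes; hence (1 - \<rho>) |G_i| \<le>
  \<rho> S. The \<open>G j\<close> sum to 1, so |G_i| \<ge> 1 - S. Together these give S \<ge> 1 -
  \<rho>, contrary to the bound on \<open>a * E\<close>. Only the indices are assumed distinct, so
  equal roots are covered.\<close>

lemma at_most_one_root_near_node:
  fixes x \<zeta> :: "nat \<Rightarrow> 'a"
  assumes n: "n \<ge> 2" and x: "inj_on x {..<n}" and c: "c \<noteq> 0"
    and f: "f = smult c (\<Prod>i<n. [:- \<zeta> i, 1:])"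
    and E: "dominated n a (\<lambda>i. av (Wcorr f n x i) / dvec av n x i) E"
    and \<rho>: "0 < \<rho>" "\<rho> < 1" "a * E < (1 - \<rho>)\<^sup>2"
    and i: "i < n" and kl: "k < n" "l < n"
    and near: "av (x i - \<zeta> k) \<le> \<rho> * dvec av n x i" "av (x i - \<zeta> l) \<le> \<rho> * dvec av n x i"
  shows "k = l"
proof (rule ccontr)
  assume "k \<noteq> l"
  define W where "W j = Wcorr f n x j" for j
  define d where "d j = dvec av n x j" for j
  define e where "e j = av (W j) / d j" for j
  define G where "G j = node_quotient \<zeta> x n ({..<n} - {k}) j" for j
  define H where "H j = node_quotient \<zeta> x n ({..<n} - {k, l}) j" for j
  have d: "d i > 0" if "i < n" for i using dvec_pos[OF n x that] by (simp add: d_def)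
  have eE: "(\<Sum>j\<in>{..<n} - {i}. e j) \<le> a * E"
    using dominatedD(2)[OF E i] by (simp add: e_def W_def d_def)
  have W: "W j = (x j - \<zeta> k) * G j" for j
    using Wcorr_eq_node_quotient[OF f c, of x j] kl
      node_quotient_insert[of "{..<n} - {k}" k \<zeta> x n j]
    by (simp add: W_def G_def insert_absorb)
  have GH: "G j = (x j - \<zeta> l) * H j" for j
  proof -
    have "insert l ({..<n} - {k, l}) = {..<n} - {k}" using kl \<open>k \<noteq> l\<close> by auto
    then show ?thesis
      using node_quotient_insert[of "{..<n} - {k, l}" l \<zeta> x n j] by (simp add: G_def H_def)
  qed
  have "(\<Sum>j<n. G j) = 1"
    unfolding G_def using sum_node_quotient[OF x, of "{..<n} - {k}" \<zeta>] kl by simp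
  then have "1 \<le> (\<Sum>j<n. av (G j))" using av_sum_le[of G "{..<n}"] by simp
  then have G1: "1 \<le> av (G i) + (\<Sum>j\<in>{..<n} - {i}. av (G j))" using i by (simp add: sum.remove)
  have "card ({..<n} - {k, l}) = n - 2"
    using kl \<open>k \<noteq> l\<close> by (subst card_Diff_subset) auto
  then have "(\<Sum>j<n. H j) = 0"
    unfolding H_def using sum_node_quotient[OF x, of "{..<n} - {k, l}" \<zeta>] n by simp
  then have "H i = - (\<Sum>j\<in>{..<n} - {i}. H j)" using i by (simp add: sum.remove add_eq_0_iff2)
  then have H1: "av (H i) \<le> (\<Sum>j\<in>{..<n} - {i}. av (H j))"
    using av_sum_le[of H "{..<n} - {i}"] by simp
  define S where "S = (\<Sum>j\<in>{..<n} - {i}. av (G j))"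
  \<comment> \<open>Both distances are needed: \<open>d j\<close> to bound \<open>G j\<close> by
    \<open>e j\<close>, and \<open>d i\<close> to compare the \<open>H j\<close> on the common scale
    of node \<open>i\<close>.\<close>
  have far: "(1 - \<rho>) * d j \<le> av (x j - z)" "(1 - \<rho>) * d i \<le> av (x j - z)"
    if "j < n" "j \<noteq> i" and z: "av (x i - z) \<le> \<rho> * d i" for j z
  proof -
    have D: "d i \<le> av (x i - x j)" "d j \<le> av (x i - x j)"
      using dvec_le[of j n i x] dvec_le'[of i n j x] i that by (auto simp: d_def)
    have "\<rho> * d i \<le> \<rho> * av (x i - x j)" using D \<rho> by (intro mult_left_mono) auto
    then have *: "(1 - \<rho>) * av (x i - x j) \<le> av (x j - z)"
      using av_triangle[of "x i" "x j" z] z by (simp add: av_diff_commute algebra_simps)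
    show "(1 - \<rho>) * d j \<le> av (x j - z)" "(1 - \<rho>) * d i \<le> av (x j - z)"
      using D \<rho> by (auto intro!: order.trans[OF _ *] mult_left_mono)
  qed
  have "(1 - \<rho>) * S \<le> (\<Sum>j\<in>{..<n} - {i}. e j)"
    unfolding S_def sum_distrib_left
  proof (rule sum_mono)
    fix j assume "j \<in> {..<n} - {i}"
    then have j: "j < n" "j \<noteq> i" by auto
    have "(1 - \<rho>) * d j * av (G j) \<le> av (W j)"
      unfolding W av_mult using far(1)[OF j, of "\<zeta> k"] near(1) by (intro mult_right_mono) (auto simp: d_def)
    then show "(1 - \<rho>) * av (G j) \<le> e j" using d[OF j(1)] by (simp add: e_def field_simps)
  qed
  then have S: "(1 - \<rho>) * S < (1 - \<rho>) * (1 - \<rho>)" using eE \<rho>(3) by (simp add: power2_eq_square)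
  then have S': "S < 1 - \<rho>" using \<rho> by (simp add: mult_less_cancel_left_pos)
  have "(1 - \<rho>) * d i * av (H i) \<le> (\<Sum>j\<in>{..<n} - {i}. (1 - \<rho>) * d i * av (H j))"
    unfolding sum_distrib_left[symmetric] using H1 \<rho> d[OF i] by (intro mult_left_mono) auto
  also have "\<dots> \<le> S"
    unfolding S_def
  proof (rule sum_mono)
    fix j assume "j \<in> {..<n} - {i}"
    then have j: "j < n" "j \<noteq> i" by auto
    show "(1 - \<rho>) * d i * av (H j) \<le> av (G j)"
      unfolding GH av_mult using far(2)[OF j, of "\<zeta> l"] near(2) by (intro mult_right_mono) (auto simp: d_def)
  qed
  finally have HS: "(1 - \<rho>) * d i * av (H i) \<le> S" .
  have "av (G i) \<le> \<rho> * d i * av (H i)"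
    unfolding GH av_mult using near(2) by (intro mult_right_mono) (auto simp: d_def)
  then have "(1 - \<rho>) * av (G i) \<le> (1 - \<rho>) * (\<rho> * d i * av (H i))"
    using \<rho> by (intro mult_left_mono) auto
  also have "\<dots> \<le> \<rho> * S" using mult_left_mono[OF HS, of \<rho>] \<rho> by (simp add: mult.left_commute mult.assoc)
  finally have "(1 - \<rho>) * av (G i) \<le> \<rho> * S" .
  moreover have "(1 - \<rho>) * (1 - S) \<le> (1 - \<rho>) * av (G i)"
    using G1 \<rho> by (intro mult_left_mono) (auto simp: S_def)
  ultimately show False using S' by (simp add: algebra_simps)
qed

text \<open>Sending each root index to a disc containing that root is injective, hence a permutation
  of the finite index set. Reordering the roots by its inverse puts one root in each disc.\<close>

lemma root_vector_near:
  fixes x \<zeta> :: "nat \<Rightarrow> 'a"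
  assumes n: "n \<ge> 2" and x: "inj_on x {..<n}" and c: "c \<noteq> 0"
    and f: "f = smult c (\<Prod>i<n. [:- \<zeta> i, 1:])"
    and a: "a \<ge> 1" and \<rho>: "0 < \<rho>" "\<rho> * (a + 1) < 1"
    and E: "dominated n a (\<lambda>i. av (Wcorr f n x i) / dvec av n x i) E"
    and ER: "E * (1 + (a - 1) * \<rho>) \<le> \<rho> * (1 - \<rho>)"
  obtains \<xi> where "f = smult c (\<Prod>i<n. [:- \<xi> i, 1:])"
    "\<And>i. i < n \<Longrightarrow> av (x i - \<xi> i) \<le> alpha_fun a E * av (Wcorr f n x i)"
    "dominated n a (\<lambda>i. av (x i - \<xi> i) / dvec av n x i) \<rho>"
proof -
  define e where "e i = av (Wcorr f n x i) / dvec av n x i" for i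
  define \<alpha> where "\<alpha> = alpha_fun a E"
  have d: "dvec av n x i > 0" if "i < n" for i using dvec_pos[OF n x that] .
  have dom: "dominated n a e E" using E by (simp add: e_def[abs_def])
  have e0: "e i \<ge> 0" if "i < n" for i using d[OF that] by (simp add: e_def)
  have E0: "E \<ge> 0" using dominatedD(1)[OF dom, of 0] e0[of 0] n by auto
  note al = alpha_fun_bounds[OF a \<rho> E0 ER, folded \<alpha>_def]
  have "\<rho> * 2 \<le> \<rho> * (a + 1)" using a \<rho> by (intro mult_left_mono) auto
  then have \<rho>2: "\<rho> < 1 / 2" using \<rho> by linarith
  have aE: "a * E < (1 - \<rho>)\<^sup>2"
  proof -
    have pos: "1 + (a - 1) * \<rho> > 0" using a \<rho> by (simp add: add_pos_nonneg)
    have "a * (E * (1 + (a - 1) * \<rho>)) \<le> a * (\<rho> * (1 - \<rho>))" using a ER by (intro mult_left_mono) auto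
    also have "\<dots> < (1 - \<rho>)\<^sup>2 * (1 + (a - 1) * \<rho>)"
    proof -
      \<comment> \<open>The difference of the two sides to be compared is \<open>1 - \<rho>\<close>
        times the slack in this inequality.\<close>
      have "2 * \<rho> + (a - 1) * \<rho>\<^sup>2 < 1"
      proof -
        have "(a - 1) * \<rho> * \<rho> \<le> (a - 1) * \<rho> * (1 / 2)" using \<rho>2 \<rho> a by (intro mult_left_mono) auto
        moreover have "a * \<rho> < 1 - \<rho>" using \<rho> by (simp add: algebra_simps)
        ultimately show ?thesis using \<rho>2 by (simp add: power2_eq_square algebra_simps)
      qed
      then have "0 < (1 - \<rho>) * (1 - (2 * \<rho> + (a - 1) * \<rho>\<^sup>2))" using \<rho>2 by simp
      also have "\<dots> = (1 - \<rho>)\<^sup>2 * (1 + (a - 1) * \<rho>) - a * (\<rho> * (1 - \<rho>))"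
        by (simp add: power2_eq_square algebra_simps)
      finally show ?thesis by simp
    qed
    finally have "(a * E) * (1 + (a - 1) * \<rho>) < (1 - \<rho>)\<^sup>2 * (1 + (a - 1) * \<rho>)" by (simp add: mult.assoc)
    then show ?thesis using pos by simp
  qed
  have "\<forall>k. \<exists>i. k < n \<longrightarrow> i < n \<and> av (x i - \<zeta> k) \<le> \<alpha> * av (Wcorr f n x i)"
    using root_near_node[OF n x c f a \<rho> E ER] unfolding \<alpha>_def by blast
  then obtain \<sigma> where \<sigma>: "k < n \<Longrightarrow> \<sigma> k < n"
      "k < n \<Longrightarrow> av (x (\<sigma> k) - \<zeta> k) \<le> \<alpha> * av (Wcorr f n x (\<sigma> k))" for k
    by metis
  have near: "av (x i - z) \<le> \<rho> * dvec av n x i"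
    if "i < n" "av (x i - z) \<le> \<alpha> * av (Wcorr f n x i)" for i z
  proof -
    have "\<alpha> * av (Wcorr f n x i) = \<alpha> * e i * dvec av n x i" using d[OF that(1)] by (simp add: e_def)
    also have "\<dots> \<le> \<alpha> * E * dvec av n x i"
      using al(2) d[OF that(1)] dominatedD(1)[OF dom that(1)]
      by (intro mult_right_mono mult_left_mono) auto
    also have "\<dots> \<le> \<rho> * dvec av n x i" using al(3) d[OF that(1)] by (intro mult_right_mono) auto
    finally show ?thesis using that(2) by linarith
  qed
  have inj: "inj_on \<sigma> {..<n}"
  proof (rule inj_onI)
    fix k l assume "k \<in> {..<n}" "l \<in> {..<n}" and eq: "\<sigma> k = \<sigma> l"
    then have kl: "k < n" "l < n" by auto
    show "k = l"
      using near[OF \<sigma>[OF kl(1)]] near[OF \<sigma>[OF kl(2)]] kl eq \<sigma>(1)[OF kl(1)] \<rho>(1) \<rho>2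
      by (intro at_most_one_root_near_node[OF n x c f E _ _ aE, of "\<sigma> k"]) auto
  qed
  have bij: "bij_betw \<sigma> {..<n} {..<n}"
    unfolding bij_betw_def using inj \<sigma>(1) by (intro conjI endo_inj_surj) auto
  define \<tau> where "\<tau> = inv_into {..<n} \<sigma>"
  have \<tau>: "bij_betw \<tau> {..<n} {..<n}" unfolding \<tau>_def by (rule bij_betw_inv_into[OF bij])
  have \<sigma>\<tau>: "\<sigma> (\<tau> i) = i" if "i < n" for i
    using bij that unfolding \<tau>_def by (intro f_inv_into_f) (auto simp: bij_betw_def)
  have \<tau>n: "\<tau> i < n" if "i < n" for i using \<tau> that by (auto simp: bij_betw_def)
  define \<xi> where "\<xi> = \<zeta> \<circ> \<tau>"
  have 1: "f = smult c (\<Prod>i<n. [:- \<xi> i, 1:])"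
    unfolding f \<xi>_def comp_def
    by (subst prod.reindex_bij_betw[OF \<tau>, of "\<lambda>i. [:- \<zeta> i, 1:]"]) simp
  have 2: "av (x i - \<xi> i) \<le> \<alpha> * av (Wcorr f n x i)" if "i < n" for i
    using \<sigma>(2)[OF \<tau>n[OF that]] \<sigma>\<tau>[OF that] by (simp add: \<xi>_def)
  have "dominated n a (\<lambda>i. av (x i - \<xi> i) / dvec av n x i) (\<alpha> * E)"
  proof (rule dominated_mono)
    show "dominated n a (\<lambda>i. \<alpha> * e i) (\<alpha> * E)" using dom al(2) by (intro dominated_scale) auto
    show "av (x i - \<xi> i) / dvec av n x i \<le> \<alpha> * e i" if "i < n" for i
      using 2[OF that] d[OF that] by (simp add: e_def divide_right_mono)
  qed
  then have 3: "dominated n a (\<lambda>i. av (x i - \<xi> i) / dvec av n x i) \<rho>"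
    by (rule dominated_le) (use al(3) a in auto)
  show ?thesis using that[OF 1 _ 3] 2 by (simp add: \<alpha>_def)
qed

end

subsection \<open>Local convergence\<close>

context abs_valued_field
begin

text \<open>The new error is the old one times 1 - \<Prod> (x_i - \<xi>_j) / (x_i - y_j). Each
  quotient is 1 + u_j, where |u_j| is the error of y_j relative to |x_i - y_j|; AM-GM then uses only
  the sum of these errors.\<close>

lemma weierstrass_correction_bound:
  fixes x y \<xi> :: "nat \<Rightarrow> 'a"
  assumes n: "degree f = n" "n \<ge> 2" and root: "root_vector f \<xi>" and i: "i < n"
    and y: "\<And>j. j < n \<Longrightarrow> j \<noteq> i \<Longrightarrow> x i \<noteq> y j"
      "\<And>j. j < n \<Longrightarrow> j \<noteq> i \<Longrightarrow> av (y j - \<xi> j) \<le> v j * av (x i - y j)"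
    and s: "(\<Sum>j\<in>{..<n} - {i}. v j) \<le> s"
  shows "av (x i - poly f (x i) / (lead_coeff f * (\<Prod>j\<in>{..<n} - {i}. x i - y j)) - \<xi> i)
    \<le> ((1 + s / real (n - 1)) ^ (n - 1) - 1) * av (x i - \<xi> i)"
proof -
  define A where "A = {..<n} - {i}"
  have A: "finite A" "card A = n - 1" using i by (auto simp: A_def)
  define u where "u j = (y j - \<xi> j) / (x i - y j)" for j
  have lc: "lead_coeff f \<noteq> 0" using n by auto
  have yA: "x i \<noteq> y j" if "j \<in> A" for j using y(1) that by (auto simp: A_def)
  have nz: "(\<Prod>j\<in>A. x i - y j) \<noteq> 0" using yA A by auto
  have "(\<Prod>j<n. x i - \<xi> j) = (x i - \<xi> i) * (\<Prod>j\<in>A. x i - \<xi> j)"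
    using i by (simp add: A_def prod.remove)
  then have "poly f (x i) / (lead_coeff f * (\<Prod>j\<in>A. x i - y j))
      = (x i - \<xi> i) * ((\<Prod>j\<in>A. x i - \<xi> j) / (\<Prod>j\<in>A. x i - y j))"
    using lc root n(1) by (simp add: root_vector_def)
  also have "(\<Prod>j\<in>A. x i - \<xi> j) / (\<Prod>j\<in>A. x i - y j) = (\<Prod>j\<in>A. 1 + u j)"
    unfolding prod_dividef[symmetric]
    using yA by (intro prod.cong) (auto simp: u_def field_simps)
  finally have "x i - poly f (x i) / (lead_coeff f * (\<Prod>j\<in>A. x i - y j)) - \<xi> i
      = - ((x i - \<xi> i) * ((\<Prod>j\<in>A. 1 + u j) - 1))" by (simp add: algebra_simps)
  then have "av (x i - poly f (x i) / (lead_coeff f * (\<Prod>j\<in>A. x i - y j)) - \<xi> i)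
      = av (x i - \<xi> i) * av ((\<Prod>j\<in>A. 1 + u j) - 1)" by (simp only: av_minus av_mult)
  also have "\<dots> \<le> av (x i - \<xi> i) * ((1 + s / real (n - 1)) ^ (n - 1) - 1)"
  proof (rule mult_left_mono)
    have uv: "av (u j) \<le> v j" if "j \<in> A" for j
      using y(2)[of j] that yA[OF that] by (simp add: A_def u_def av_divide field_simps)
    have "(\<Sum>j\<in>A. 1 + av (u j)) \<le> (\<Sum>j\<in>A. 1 + v j)" using uv by (intro sum_mono) auto
    also have "\<dots> \<le> (n - 1) + s" using s A by (simp add: sum.distrib A_def[symmetric])
    finally have "(\<Prod>j\<in>A. 1 + av (u j)) \<le> (((n - 1) + s) / card A) ^ card A"
      using A by (intro prod_le_mean_power) auto
    also have "((n - 1) + s) / card A = 1 + s / real (n - 1)" using n A by (simp add: field_simps)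
    finally show "av ((\<Prod>j\<in>A. 1 + u j) - 1) \<le> (1 + s / real (n - 1)) ^ (n - 1) - 1"
      using av_prod_diff_one_le[OF A(1), of u] A by simp
  qed simp
  finally show ?thesis by (simp add: A_def mult.commute)
qed

end

definition contraction_factor :: "nat \<Rightarrow> real \<Rightarrow> real \<Rightarrow> real" where
  "contraction_factor n a \<rho> = (1 + a * \<rho> / real (n - 1)) ^ (n - 1) - 1"

text \<open>AM-GM on \<open>n - 1\<close> factors \<open>1 + a \<rho> / (n - 1)\<close> and one factor \<open>1 + 2 \<rho>\<close> explains the constant
  \<open>a + 2\<close> in \<open>\<rho>\<close>.\<close>
lemma contraction_factor_bounds:
  assumes n: "n \<ge> 2" and a: "a \<ge> 1" and \<rho>: "\<rho> > 0" and b: "(1 + (a + 2) * \<rho> / n) ^ n \<le> 2"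
  defines "B \<equiv> contraction_factor n a \<rho>"
  shows "0 < B" "(1 + B) * (1 + 2 * \<rho>) \<le> 2" "B < 1" "2 * ((1 + B) * \<rho>) \<le> 1 - B"
proof -
  have u: "a * \<rho> / real (n - 1) > 0" using a \<rho> n by (simp add: zero_less_mult_iff)
  have "1 < (1 + a * \<rho> / real (n - 1)) ^ (n - 1)" using u n by (intro one_less_power) auto
  then show B: "0 < B" by (simp add: B_def contraction_factor_def)
  \<comment> \<open>Index 0 carries the exceptional factor; the remaining \<open>n - 1\<close>
    factors are equal.\<close>
  define v where "v i = (if i = 0 then 1 + 2 * \<rho> else 1 + a * \<rho> / real (n - 1))" for i :: nat
  have v0: "v i \<ge> 0" for i using u \<rho> by (auto simp: v_def)
  have n0: "{..<n} = insert 0 {1..<n}" using n by auto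
  have "(\<Prod>i<n. v i) = (1 + 2 * \<rho>) * (\<Prod>i\<in>{1..<n}. v i)"
    unfolding n0 by (simp add: v_def)
  also have "(\<Prod>i\<in>{1..<n}. v i) = (\<Prod>i\<in>{1..<n}. 1 + a * \<rho> / real (n - 1))"
    by (intro prod.cong) (auto simp: v_def)
  finally have prod: "(\<Prod>i<n. v i) = (1 + 2 * \<rho>) * (1 + B)"
    using n by (simp add: B_def contraction_factor_def of_nat_diff)
  have "(\<Sum>i<n. v i) = (1 + 2 * \<rho>) + (\<Sum>i\<in>{1..<n}. v i)"
    unfolding n0 by (simp add: v_def)
  also have "(\<Sum>i\<in>{1..<n}. v i) = (\<Sum>i\<in>{1..<n}. 1 + a * \<rho> / real (n - 1))"
    by (intro sum.cong) (auto simp: v_def)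
  also have "\<dots> = real n - 1 + a * \<rho>" using n by (simp add: distrib_left of_nat_diff)
  finally have "(\<Sum>i<n. v i) = n + (a + 2) * \<rho>" by (simp add: algebra_simps)
  then have "(\<Prod>i<n. v i) \<le> ((n + (a + 2) * \<rho>) / n) ^ n"
    using prod_le_mean_power[of "{..<n}" v "n + (a + 2) * \<rho>"] v0 by simp
  also have "(n + (a + 2) * \<rho>) / n = 1 + (a + 2) * \<rho> / n" using n by (simp add: field_simps)
  finally show *: "(1 + B) * (1 + 2 * \<rho>) \<le> 2" using b prod by (simp add: mult.commute)
  then show "2 * ((1 + B) * \<rho>) \<le> 1 - B" by (simp add: algebra_simps)
  have "(1 + B) * \<rho> > 0" using B \<rho> by simp
  then show "B < 1" using \<open>2 * ((1 + B) * \<rho>) \<le> 1 - B\<close> by linarith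
qed

context abs_valued_field
begin

text \<open>Each level of the recursion gains one factor \<open>\<kappa>\<close>: if level
  \<open>M\<close> has relative errors at most \<open>\<kappa> ^ M * e j\<close>, their sum is at
  most \<open>\<kappa> ^ Suc M * (a * \<rho>)\<close>, and convexity moves the power of
  \<open>\<kappa>\<close> in front of \<open>B\<close>.\<close>

lemma Tmap_error:
  fixes x \<xi> :: "nat \<Rightarrow> 'a"
  assumes n: "degree f = n" "n \<ge> 2" and root: "root_vector f \<xi>" and x: "inj_on x {..<n}"
    and a: "a \<ge> 1" and \<rho>: "\<rho> > 0" and b: "(1 + (a + 2) * \<rho> / n) ^ n \<le> 2"
    and \<kappa>: "0 \<le> \<kappa>" "\<kappa> \<le> 1"
    and dom: "dominated n a (\<lambda>i. av (x i - \<xi> i) / dvec av n x i) (\<kappa> * \<rho>)"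
  defines "B \<equiv> contraction_factor n a \<rho>"
  shows "x \<in> Dom f M"
    "M \<ge> 1 \<Longrightarrow> j < n \<Longrightarrow> av (Tmap f M x j - \<xi> j) \<le> \<kappa> ^ M * B * av (x j - \<xi> j)"
proof -
  define d where "d i = dvec av n x i" for i
  define e where "e i = av (x i - \<xi> i) / d i" for i
  note B = contraction_factor_bounds[OF n(2) a \<rho> b, folded B_def]
  have d: "d i > 0" if "i < n" for i using dvec_pos[OF n(2) x that] by (simp add: d_def)
  have dom': "dominated n a e (\<kappa> * \<rho>)" using dom by (simp add: e_def[abs_def] d_def)
  have e0: "e i \<ge> 0" if "i < n" for i using d[OF that] by (simp add: e_def)
  have e\<rho>: "e i \<le> \<rho>" if "i < n" for i
  proof -
    have "\<kappa> * \<rho> \<le> 1 * \<rho>" using \<kappa> \<rho> by (intro mult_right_mono) auto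
    then show ?thesis using dominatedD(1)[OF dom' that] by linarith
  qed
  \<comment> \<open>Stated relative to \<open>\<bar>x\<^sub>i - T\<^sub>j\<bar>\<close> so that \<open>M = 0\<close>, where no contraction is available yet, fits the
    same induction.\<close>
  define Q where "Q M \<longleftrightarrow> (\<forall>i<n. \<forall>j<n. i \<noteq> j \<longrightarrow> x i \<noteq> Tmap f M x j \<and>
      av (Tmap f M x j - \<xi> j) \<le> \<kappa> ^ M * e j * av (x i - Tmap f M x j))" for M
  have err: "av (Tmap f (Suc M) x i - \<xi> i) \<le> \<kappa> ^ Suc M * B * av (x i - \<xi> i)"
    if "Q M" "i < n" for M i
  proof -
    define \<mu> where "\<mu> = \<kappa> ^ Suc M"
    have \<mu>: "0 \<le> \<mu>" "\<mu> \<le> 1" unfolding \<mu>_def using \<kappa> by (auto intro: power_le_one mult_le_one)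
    have "(\<Sum>j\<in>{..<n} - {i}. \<kappa> ^ M * e j) \<le> \<kappa> ^ M * (a * (\<kappa> * \<rho>))"
      unfolding sum_distrib_left[symmetric]
      using dominatedD(2)[OF dom' that(2)] \<kappa> by (intro mult_left_mono) auto
    also have "\<dots> = \<mu> * (a * \<rho>)" by (simp add: \<mu>_def mult_ac)
    finally have "av (x i - poly f (x i) / (lead_coeff f * (\<Prod>j\<in>{..<n} - {i}. x i - Tmap f M x j)) - \<xi> i)
        \<le> ((1 + \<mu> * (a * \<rho>) / real (n - 1)) ^ (n - 1) - 1) * av (x i - \<xi> i)"
      using that by (intro weierstrass_correction_bound[OF n root that(2)]) (auto simp: Q_def)
    then have "av (Tmap f (Suc M) x i - \<xi> i)
        \<le> ((1 + \<mu> * (a * \<rho>) / real (n - 1)) ^ (n - 1) - 1) * av (x i - \<xi> i)"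
      unfolding Tmap.simps n(1) .
    also have "\<dots> \<le> \<mu> * B * av (x i - \<xi> i)"
      using power_convex_le[OF \<mu>, of "a * \<rho> / real (n - 1)" "n - 1"] a \<rho> n
      by (intro mult_right_mono) (auto simp: B_def contraction_factor_def)
    finally show ?thesis by (simp add: \<mu>_def)
  qed
  have Q: "Q M" for M
  proof (induction M)
    case 0
    show ?case unfolding Q_def
    proof (intro allI impI conjI)
      fix i j assume ij: "i < n" "j < n" "i \<noteq> j"
      show "x i \<noteq> Tmap f 0 x j" using ij x by (auto simp: inj_on_def)
      have "av (x j - \<xi> j) = e j * d j" using d[OF ij(2)] by (simp add: e_def)
      also have "\<dots> \<le> e j * av (x i - x j)"
        using dvec_le'[of i n j x] ij e0 by (intro mult_left_mono) (auto simp: d_def)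
      finally show "av (Tmap f 0 x j - \<xi> j) \<le> \<kappa> ^ 0 * e j * av (x i - Tmap f 0 x j)" by simp
    qed
  next
    case (Suc M)
    show ?case unfolding Q_def
    proof (intro allI impI)
      fix i j assume ij: "i < n" "j < n" "i \<noteq> j"
      define y where "y = Tmap f (Suc M) x j"
      define D where "D = av (x i - x j)"
      define \<mu> where "\<mu> = \<kappa> ^ Suc M"
      have \<mu>: "0 \<le> \<mu>" "\<mu> \<le> 1" unfolding \<mu>_def using \<kappa> by (auto intro: power_le_one mult_le_one)
      have D: "d j \<le> D" "D > 0"
        using dvec_le'[of i n j x] ij d[OF ij(2)] by (auto simp: d_def D_def simp del: av_pos_iff)
      have "av (x j - \<xi> j) = e j * d j" using d[OF ij(2)] by (simp add: e_def)
      also have "\<dots> \<le> e j * D" using D e0[OF ij(2)] by (intro mult_left_mono)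
      finally have \<delta>: "av (x j - \<xi> j) \<le> e j * D" .
      also have "\<dots> \<le> \<rho> * D" using D e\<rho>[OF ij(2)] by (intro mult_right_mono) auto
      finally have \<delta>\<rho>: "av (x j - \<xi> j) \<le> \<rho> * D" .
      have y: "av (y - \<xi> j) \<le> \<mu> * B * av (x j - \<xi> j)"
        using err[OF Suc ij(2)] by (simp add: y_def \<mu>_def)
      also have "\<dots> \<le> \<mu> * B * (e j * D)" using \<delta> \<mu> B by (intro mult_left_mono) auto
      finally have y1: "av (y - \<xi> j) \<le> \<mu> * e j * (B * D)" by (simp add: mult_ac)
      have "\<mu> * B * av (x j - \<xi> j) \<le> 1 * B * (\<rho> * D)"
        using \<mu> B \<delta>\<rho> by (intro mult_mono) auto
      then have y2: "av (y - \<xi> j) \<le> B * (\<rho> * D)" using y by simp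
      have "D \<le> av (x i - y) + av (y - \<xi> j) + av (x j - \<xi> j)"
        using av_triangle[of "x i" "x j" y] av_triangle[of y "x j" "\<xi> j"]
        by (simp add: D_def av_diff_commute)
      then have "(1 - (1 + B) * \<rho>) * D \<le> av (x i - y)" using y2 \<delta>\<rho> by (simp add: algebra_simps)
      \<comment> \<open>Since (1 + B) \<rho> \<le> 1 - B, at least the fraction \<open>B\<close> of
        the distance \<open>D\<close> survives. This cancels the \<open>B\<close> in
        \<open>y1\<close> and restores the relative form of \<open>Q\<close>.\<close>
      moreover have "B * D \<le> (1 - (1 + B) * \<rho>) * D" using B D by (intro mult_right_mono) auto
      ultimately have BD: "B * D \<le> av (x i - y)" by linarith
      moreover have "B * D > 0" using B D by simp
      ultimately have "x i \<noteq> y" by auto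
      moreover have "\<mu> * e j * (B * D) \<le> \<mu> * e j * av (x i - y)"
        using BD \<mu> e0[OF ij(2)] by (intro mult_left_mono) auto
      ultimately show "x i \<noteq> Tmap f (Suc M) x j \<and>
          av (Tmap f (Suc M) x j - \<xi> j) \<le> \<kappa> ^ Suc M * e j * av (x i - Tmap f (Suc M) x j)"
        using y1 unfolding y_def \<mu>_def by linarith
    qed
  qed
  show "x \<in> Dom f M"
  proof (induction M)
    case (Suc M)
    then show ?case using Q[of M] n by (auto simp: Q_def)
  qed simp
  show "av (Tmap f M x j - \<xi> j) \<le> \<kappa> ^ M * B * av (x j - \<xi> j)" if "M \<ge> 1" "j < n"
    using err[OF Q that(2), of "M - 1"] that(1) by simp
qed

section \<open>Invariance of the error bound and uniqueness of the nearby root-vector\<close>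

text \<open>One step multiplies errors by at most \<open>B\<close> and distances between components
  by at least \<open>B\<close>, so no error quotient grows.\<close>

lemma Tmap_invariant:
  fixes x \<xi> :: "nat \<Rightarrow> 'a"
  assumes n: "degree f = n" "n \<ge> 2" and root: "root_vector f \<xi>" and x: "inj_on x {..<n}"
    and a: "a \<ge> 1" and \<rho>: "\<rho> > 0" and b: "(1 + (a + 2) * \<rho> / n) ^ n \<le> 2"
    and dom: "dominated n a (\<lambda>i. av (x i - \<xi> i) / dvec av n x i) \<rho>"
    and M: "M \<ge> 1"
  shows "inj_on (Tmap f M x) {..<n}"
    "dominated n a (\<lambda>i. av (Tmap f M x i - \<xi> i) / dvec av n (Tmap f M x) i) \<rho>"
proof -
  define B where "B = contraction_factor n a \<rho>"
  define y where "y = Tmap f M x"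
  note B = contraction_factor_bounds[OF n(2) a \<rho> b, folded B_def]
  have d: "dvec av n x i > 0" if "i < n" for i using dvec_pos[OF n(2) x that] .
  have err: "av (y j - \<xi> j) \<le> B * av (x j - \<xi> j)" if "j < n" for j
    using Tmap_error(2)[OF n root x a \<rho> b, of 1, OF _ _ _ M that] dom by (simp add: y_def B_def)
  have \<delta>: "av (x i - \<xi> i) \<le> \<rho> * av (x i - x j)" if "i < n" "j < n" "i \<noteq> j" for i j
  proof -
    have "av (x i - \<xi> i) \<le> \<rho> * dvec av n x i"
      using dominatedD(1)[OF dom that(1)] d[OF that(1)] by (simp add: field_simps)
    also have "\<dots> \<le> \<rho> * av (x i - x j)" using dvec_le[of j n i x] that \<rho> by (intro mult_left_mono) auto
    finally show ?thesis .
  qed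
  have step: "av (x i - y i) \<le> (1 + B) * \<rho> * av (x i - x j)" if "i < n" "j < n" "i \<noteq> j" for i j
  proof -
    have "av (x i - y i) \<le> av (x i - \<xi> i) + B * av (x i - \<xi> i)"
      using av_triangle[of "x i" "y i" "\<xi> i"] err[OF that(1)] by (simp add: av_diff_commute)
    also have "\<dots> = (1 + B) * av (x i - \<xi> i)" by (simp add: algebra_simps)
    also have "\<dots> \<le> (1 + B) * (\<rho> * av (x i - x j))" using \<delta>[OF that] B by (intro mult_left_mono) auto
    finally show ?thesis by (simp add: mult.assoc)
  qed
  have sep: "B * av (x i - x j) \<le> av (y i - y j)" if "i < n" "j < n" "i \<noteq> j" for i j
  proof -
    have "av (x i - x j) \<le> av (x i - y i) + av (y i - y j) + av (x j - y j)"
      using av_triangle[of "x i" "x j" "y i"] av_triangle[of "y i" "x j" "y j"]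
      by (simp add: av_diff_commute)
    then have "(1 - 2 * ((1 + B) * \<rho>)) * av (x i - x j) \<le> av (y i - y j)"
      using step[OF that] step[OF that(2,1)] that(3) by (simp add: algebra_simps av_diff_commute)
    \<comment> \<open>Both components may move, which is why 2 (1 + B) \<rho> \<le> 1 - B is
      required.\<close>
    moreover have "B * av (x i - x j) \<le> (1 - 2 * ((1 + B) * \<rho>)) * av (x i - x j)"
      using B by (intro mult_right_mono) auto
    ultimately show ?thesis by linarith
  qed
  show "inj_on (Tmap f M x) {..<n}"
  proof (rule inj_onI, rule ccontr)
    fix i j assume ij: "i \<in> {..<n}" "j \<in> {..<n}" "Tmap f M x i = Tmap f M x j" "i \<noteq> j"
    then have "av (x i - x j) > 0" using x by (auto simp: inj_on_def)
    then have "B * av (x i - x j) > 0" using B by (simp del: av_pos_iff)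
    then show False using sep[of i j] ij by (simp add: y_def del: av_pos_iff)
  qed
  show "dominated n a (\<lambda>i. av (Tmap f M x i - \<xi> i) / dvec av n (Tmap f M x) i) \<rho>"
    unfolding y_def[symmetric]
  proof (rule dominated_mono[OF dom])
    fix i assume i: "i < n"
    have "B * dvec av n x i \<le> dvec av n y i"
    proof (rule dvec_ge[OF n(2)])
      fix j assume j: "j < n" "j \<noteq> i"
      have "B * dvec av n x i \<le> B * av (x i - x j)"
        using dvec_le[of j n i x] j B by (intro mult_left_mono) auto
      also have "\<dots> \<le> av (y i - y j)" using sep[of i j] i j by auto
      finally show "B * dvec av n x i \<le> av (y i - y j)" .
    qed
    then have "av (y i - \<xi> i) / dvec av n y i \<le> (B * av (x i - \<xi> i)) / (B * dvec av n x i)"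
      using err[OF i] d[OF i] B by (intro frac_le) auto
    then show "av (y i - \<xi> i) / dvec av n y i \<le> av (x i - \<xi> i) / dvec av n x i" using B by simp
  qed
qed

text \<open>If \<open>\<xi>' i\<close> were \<open>\<xi> j\<close> with j different from i, then
  \<open>x i\<close> and \<open>x j\<close> would both lie within less than half their distance of
  one point. This identifies root-vectors localized from different iterates.\<close>

lemma near_root_vector_unique:
  fixes x \<xi> \<xi>' :: "nat \<Rightarrow> 'a"
  assumes n: "degree f = n" "n \<ge> 2" and x: "inj_on x {..<n}" and f: "f \<noteq> 0"
    and root: "root_vector f \<xi>" "root_vector f \<xi>'" and \<rho>: "\<rho> < 1 / 2"
    and dom: "dominated n a (\<lambda>i. av (x i - \<xi> i) / dvec av n x i) \<rho>"
      "dominated n a (\<lambda>i. av (x i - \<xi>' i) / dvec av n x i) \<rho>"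
    and i: "i < n"
  shows "\<xi>' i = \<xi> i"
proof (rule ccontr)
  assume neq: "\<xi>' i \<noteq> \<xi> i"
  have "poly f (\<xi>' i) = 0" using root(2) i n(1) by (auto simp: root_vector_def intro!: prod_zero)
  then have "(\<Prod>j<n. \<xi>' i - \<xi> j) = 0" using root(1) f unfolding root_vector_def n(1)[symmetric] by simp
  then obtain j where j: "j < n" "\<xi>' i = \<xi> j" by auto
  then have ij: "j \<noteq> i" using neq by auto
  have \<delta>: "av (x k - \<eta> k) \<le> \<rho> * dvec av n x k"
    if "dominated n a (\<lambda>i. av (x i - \<eta> i) / dvec av n x i) \<rho>" "k < n" for k \<eta>
    using dominatedD(1)[OF that] dvec_pos[OF n(2) x that(2)] by (simp add: field_simps)
  define D where "D = av (x i - x j)"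
  have D0: "D > 0" using x i j ij by (auto simp: D_def inj_on_def)
  have dD: "dvec av n x i \<le> D" "dvec av n x j \<le> D"
    using dvec_le[of j n i x] dvec_le'[of i n j x] i j ij by (auto simp: D_def)
  have "\<rho> \<ge> 0"
    using dominatedD(1)[OF dom(1) i] dvec_pos[OF n(2) x i] by (meson av_nonneg divide_nonneg_pos order_trans)
  then have "\<rho> * dvec av n x i \<le> \<rho> * D" "\<rho> * dvec av n x j \<le> \<rho> * D"
    using dD by (auto intro: mult_left_mono)
  moreover have "D \<le> av (x i - \<xi>' i) + av (x j - \<xi> j)"
    using av_triangle[of "x i" "x j" "\<xi> j"] j by (simp add: D_def av_diff_commute)
  ultimately have "D \<le> 2 * (\<rho> * D)" using \<delta>[OF dom(1) j(1)] \<delta>[OF dom(2) i] by linarith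
  moreover have "\<rho> * D < 1 / 2 * D" using \<rho> D0 by (intro mult_strict_right_mono)
  ultimately show False by linarith
qed

text \<open>Distinctness yields simple zeros; the distance estimate bounds the separation of all
  iterates from below by that of the roots.\<close>

lemma root_vector_separation:
  fixes x \<xi> :: "nat \<Rightarrow> 'a"
  assumes n: "n \<ge> 2" and x: "inj_on x {..<n}" and \<rho>: "0 < \<rho>" "\<rho> < 1 / 2"
    and dom: "dominated n a (\<lambda>i. av (x i - \<xi> i) / dvec av n x i) \<rho>"
    and ij: "i < n" "j < n" "i \<noteq> j"
  shows "\<xi> i \<noteq> \<xi> j" "av (\<xi> i - \<xi> j) \<le> 2 * av (x i - x j)"
proof -
  define D where "D = av (x i - x j)"
  have D0: "D > 0" using x ij by (auto simp: D_def inj_on_def)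
  have \<delta>: "av (x k - \<xi> k) \<le> \<rho> * D" if "k < n" "dvec av n x k \<le> D" for k
  proof -
    have "av (x k - \<xi> k) \<le> \<rho> * dvec av n x k"
      using dominatedD(1)[OF dom that(1)] dvec_pos[OF n x that(1)] by (simp add: field_simps)
    also have "\<dots> \<le> \<rho> * D" using that \<rho> by (intro mult_left_mono) auto
    finally show ?thesis .
  qed
  have dD: "dvec av n x i \<le> D" "dvec av n x j \<le> D"
    using dvec_le[of j n i x] dvec_le'[of i n j x] ij by (auto simp: D_def)
  note \<delta>\<delta> = \<delta>[OF ij(1) dD(1)] \<delta>[OF ij(2) dD(2)]
  have r: "\<rho> * D < 1 / 2 * D" using \<rho> D0 by (intro mult_strict_right_mono)
  have "av (\<xi> i - \<xi> j) \<le> av (x i - \<xi> i) + D + av (x j - \<xi> j)"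
    using av_triangle[of "\<xi> i" "\<xi> j" "x i"] av_triangle[of "x i" "\<xi> j" "x j"]
    by (simp add: D_def av_diff_commute)
  then show "av (\<xi> i - \<xi> j) \<le> 2 * av (x i - x j)" using \<delta>\<delta> r unfolding D_def[symmetric] by linarith
  have "D \<le> av (x i - \<xi> i) + av (\<xi> i - \<xi> j) + av (x j - \<xi> j)"
    using av_triangle[of "x i" "x j" "\<xi> i"] av_triangle[of "\<xi> i" "x j" "\<xi> j"]
    by (simp add: D_def av_diff_commute)
  then have "av (\<xi> i - \<xi> j) > 0" using \<delta>\<delta> r by linarith
  then show "\<xi> i \<noteq> \<xi> j" by auto
qed

end

section \<open>Simple zeros, geometric convergence and its order\<close>

lemma rsquarefree_prod_linear:
  fixes \<xi> :: "nat \<Rightarrow> 'a::field"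
  assumes f: "f = smult c (\<Prod>i<n. [:- \<xi> i, 1:])" and c: "c \<noteq> 0" and \<xi>: "inj_on \<xi> {..<n}"
  shows "rsquarefree f"
  unfolding rsquarefree_def
proof (intro conjI allI)
  show f0: "f \<noteq> 0" using c by (simp add: f)
  fix z
  show "order z f = 0 \<or> order z f = 1"
  proof (cases "poly f z = 0")
    case True
    then obtain i where i: "i < n" "z = \<xi> i" using c by (auto simp: f poly_prod)
    define g where "g = smult c (\<Prod>j\<in>{..<n} - {i}. [:- \<xi> j, 1:])"
    have fg: "f = [:- z, 1:] * g" using i by (simp add: f g_def prod.remove[of "{..<n}" i])
    have "poly g z \<noteq> 0" using i c \<xi> by (auto simp: g_def poly_prod inj_on_def)
    moreover have "order z f = order z [:- z, 1:] + order z g"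
      unfolding fg by (rule order_mult) (use f0 fg in auto)
    ultimately show ?thesis using order_power_n_n[of z 1] by (simp add: order_0I)
  qed (simp add: order_0I)
qed

text \<open>The last bound is Bernoulli's inequality: 2 = (1 + b)^n \<ge> 1 + n b.\<close>

lemma root_2_bounds:
  assumes "n \<ge> 1"
  defines "b \<equiv> root n 2 - 1"
  shows "0 < b" "(1 + b) ^ n = 2" "real n * b \<le> 1"
proof -
  show b: "0 < b" using assms by (simp add: b_def)
  show p: "(1 + b) ^ n = 2" using assms by (simp add: b_def)
  show "real n * b \<le> 1" using Bernoulli_inequality[of b n] b p by simp
qed

context abs_valued_field
begin

lemma err_max_ge:
  assumes "i < n"
  shows "av (x i - \<xi> i) \<le> err_max av n x \<xi>"
  unfolding err_max_def using assms by (intro Max_ge) auto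

lemma err_max_le:
  assumes "n \<ge> 1" "\<And>i. i < n \<Longrightarrow> av (x i - \<xi> i) \<le> c"
  shows "err_max av n x \<xi> \<le> c"
proof -
  have "0 \<in> {..<n}" using assms(1) by simp
  then show ?thesis unfolding err_max_def using assms(2) by (intro Max.boundedI) auto
qed

lemma converges_toI:
  assumes c: "0 \<le> c" "c < 1"
    and step: "\<And>k i. i < n \<Longrightarrow> av (xs (Suc k) i - \<xi> i) \<le> c * av (xs k i - \<xi> i)"
  shows "converges_to av n xs \<xi>"
  unfolding converges_to_def
proof (intro allI impI)
  fix i \<epsilon> assume i: "i < n" and \<epsilon>: "(\<epsilon>::real) > 0"
  have le: "av (xs k i - \<xi> i) \<le> c ^ k * av (xs 0 i - \<xi> i)" for k
  proof (induction k)
    case (Suc k)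
    have "c * av (xs k i - \<xi> i) \<le> c * (c ^ k * av (xs 0 i - \<xi> i))"
      using Suc c by (intro mult_left_mono)
    then show ?case using step[OF i, of k] by (simp add: mult.assoc)
  qed simp
  have "(\<lambda>k. c ^ k * av (xs 0 i - \<xi> i)) \<longlonglongrightarrow> 0 * av (xs 0 i - \<xi> i)"
    using c by (intro tendsto_mult_right LIMSEQ_power_zero) auto
  then have "eventually (\<lambda>k. c ^ k * av (xs 0 i - \<xi> i) < \<epsilon>) sequentially"
    using \<epsilon> by (auto intro: order_tendstoD(2))
  then show "\<exists>K. \<forall>k\<ge>K. av (xs k i - \<xi> i) < \<epsilon>"
    using le unfolding eventually_sequentially by (meson order_le_less_trans)
qed

text \<open>The iterates keep separation at least \<delta> / 2, so error quotients are at most 2 m /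
  \<delta> for the maximal error m. Thus \<open>\<kappa>\<close> may be taken at most
  \<open>C * m\<close>, and \<open>N\<close> levels give (C m)^N m.\<close>

lemma Tmap_conv_order:
  fixes \<xi> :: "nat \<Rightarrow> 'a"
  assumes n: "degree f = n" "n \<ge> 2" and root: "root_vector f \<xi>" and N: "N \<ge> 1"
    and a: "a \<ge> 1" and \<rho>: "0 < \<rho>" "\<rho> < 1 / 2" and b: "(1 + (a + 2) * \<rho> / n) ^ n \<le> 2"
    and x: "\<And>k. inj_on (xs k) {..<n}"
    and dom: "\<And>k. dominated n a (\<lambda>i. av (xs k i - \<xi> i) / dvec av n (xs k) i) \<rho>"
    and step: "\<And>k. xs (Suc k) = Tmap f N (xs k)"
  shows "conv_order av n xs \<xi> (N + 1)"
proof -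
  note B = contraction_factor_bounds[OF n(2) a \<rho>(1) b]
  have inj: "inj_on \<xi> {..<n}"
    using root_vector_separation(1)[OF n(2) x \<rho> dom] by (meson inj_onI lessThan_iff)
  define \<delta> where "\<delta> = Min (dvec av n \<xi> ` {..<n})"
  have "0 \<in> {..<n}" using n by simp
  then have ne: "dvec av n \<xi> ` {..<n} \<noteq> {}" by blast
  have \<delta>: "\<delta> > 0" unfolding \<delta>_def using ne dvec_pos[OF n(2) inj] by (subst Min_gr_iff) auto
  \<comment> \<open>The factor \<open>n - 1\<close> covers a sum of \<open>n - 1\<close> quotients;
    \<open>\<rho>\<close> is divided out because the error bound has the form
    \<open>\<kappa> * \<rho>\<close>.\<close>
  define C where "C = 2 * real (n - 1) / (\<delta> * \<rho>)"
  have C: "C \<ge> 0" using \<delta> \<rho> by (simp add: C_def)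
  have "err_max av n (xs (Suc k)) \<xi> \<le> C ^ N * err_max av n (xs k) \<xi> ^ (N + 1)" for k
  proof -
    define m where "m = err_max av n (xs k) \<xi>"
    define \<kappa> where "\<kappa> = min 1 (C * m)"
    have m_ge: "av (xs k i - \<xi> i) \<le> m" if "i < n" for i unfolding m_def by (rule err_max_ge[OF that])
    have m0: "m \<ge> 0" using m_ge[of 0] n by (meson av_nonneg order_trans zero_less_numeral order_less_le_trans)
    have \<kappa>: "0 \<le> \<kappa>" "\<kappa> \<le> 1" "\<kappa> \<le> C * m" using C m0 by (auto simp: \<kappa>_def)
    have d: "\<delta> / 2 \<le> dvec av n (xs k) i" if i: "i < n" for i
    proof (rule dvec_ge[OF n(2)])
      fix j assume j: "j < n" "j \<noteq> i"
      have "\<delta> \<le> dvec av n \<xi> i" unfolding \<delta>_def using i by (intro Min_le) auto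
      also have "\<dots> \<le> av (\<xi> i - \<xi> j)" by (rule dvec_le[OF j])
      also have "\<dots> \<le> 2 * av (xs k i - xs k j)"
        using root_vector_separation(2)[OF n(2) x \<rho> dom i j(1)] j(2) by auto
      finally show "\<delta> / 2 \<le> av (xs k i - xs k j)" by simp
    qed
    have "av (xs k i - \<xi> i) / dvec av n (xs k) i \<le> 2 * m / \<delta>" if "i < n" for i
      using frac_le[OF m0 m_ge[OF that] _ d[OF that]] \<delta> by (simp add: mult.commute)
    then have e: "dominated n a (\<lambda>i. av (xs k i - \<xi> i) / dvec av n (xs k) i) (C * m * \<rho>)"
    proof (rule dominated_mono[rotated])
      have eq: "C * m * \<rho> = real (n - 1) * (2 * m / \<delta>)" using \<rho> by (simp add: C_def)
      have "1 * (2 * m / \<delta>) \<le> real (n - 1) * (2 * m / \<delta>)"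
        using n m0 \<delta> by (intro mult_right_mono) auto
      moreover have "1 * (C * m * \<rho>) \<le> a * (C * m * \<rho>)"
        using a C m0 \<rho> by (intro mult_right_mono) auto
      ultimately show "dominated n a (\<lambda>i. 2 * m / \<delta>) (C * m * \<rho>)"
        using n unfolding dominated_def eq by (simp add: of_nat_diff)
    qed
    \<comment> \<open>If \<open>C * m\<close> exceeds 1, then \<open>\<kappa> = 1\<close> and the
      standing bound \<open>dom\<close> serves instead of \<open>e\<close>.\<close>
    then have "dominated n a (\<lambda>i. av (xs k i - \<xi> i) / dvec av n (xs k) i) (\<kappa> * \<rho>)"
      using dom[of k] by (cases "C * m \<le> 1") (simp_all add: \<kappa>_def)
    note err = Tmap_error(2)[OF n root x a \<rho>(1) b \<kappa>(1,2) this N]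
    have "err_max av n (xs (Suc k)) \<xi> \<le> (C * m) ^ N * m"
    proof (rule err_max_le)
      fix i assume i: "i < n"
      have "av (xs (Suc k) i - \<xi> i) \<le> (\<kappa> ^ N * contraction_factor n a \<rho>) * av (xs k i - \<xi> i)"
        using err[OF i] by (simp add: step)
      also have "\<dots> \<le> (\<kappa> ^ N * 1) * m"
        using B \<kappa> m_ge[OF i] by (intro mult_mono mult_left_mono) auto
      also have "\<dots> \<le> (C * m) ^ N * m"
        using \<kappa> m0 by (simp add: mult_right_mono power_mono)
      finally show "av (xs (Suc k) i - \<xi> i) \<le> (C * m) ^ N * m" .
    qed (use n in simp)
    then show ?thesis by (simp add: m_def power_mult_distrib mult_ac)
  qed
  then show ?thesis unfolding conv_order_def using C by (intro exI[of _ "C ^ N"]) auto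
qed

end


section \<open>From the initial condition to convergence and the a posteriori error bound\<close>

theorem theorem3p5:
  fixes av :: "'a::field \<Rightarrow> real" and f :: "'a poly" and N :: nat and p :: ereal
    and x0 :: "nat \<Rightarrow> 'a"
  assumes "absolute_value av" and "alg_closed TYPE('a)"
    and "degree f \<ge> 2" and "N \<ge> 1" and "1 \<le> p"
    and "\<forall>i<degree f. \<forall>j<degree f. i \<noteq> j \<longrightarrow> x0 i \<noteq> x0 j"
    and "Ef av p f x0 <
      (let n = real (degree f); a = (n - 1) powr inv_q p; b = root (degree f) 2 - 1
       in n * b * (a + 2 - n * b) / ((a + 2) * (a + 2 + n * (a - 1) * b)))"
  shows "rsquarefree f \<and>
    (let xs = (\<lambda>k. (Tmap f N ^^ k) x0); n = real (degree f);
         a = (n - 1) powr inv_q p; b = root (degree f) 2 - 1;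
         R = n * b * (a + 2 - n * b) / ((a + 2) * (a + 2 + n * (a - 1) * b))
     in (\<forall>k. xs k \<in> Dom f N) \<and>
        (\<exists>\<xi>. root_vector f \<xi> \<and> converges_to av (degree f) xs \<xi> \<and>
             conv_order av (degree f) xs \<xi> (N + 1) \<and>
             (\<forall>k. Ef av p f (xs k) \<le> R \<longrightarrow>
                (\<forall>i<degree f. av (xs k i - \<xi> i) \<le>
                   alpha_fun a (Ef av p f (xs k)) * av (Wcorr f (degree f) (xs k) i)))))"
proof -
  interpret abs_valued_field av using assms(1) by unfold_locales
  define n where "n = degree f"
  define a where "a = (real n - 1) powr inv_q p"
  define b where "b = root n 2 - 1"
  define R where "R = real n * b * (a + 2 - real n * b) / ((a + 2) * (a + 2 + real n * (a - 1) * b))"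
  define \<rho> where "\<rho> = real n * b / (a + 2)"
  define xs where "xs k = (Tmap f N ^^ k) x0" for k
  define c where "c = lead_coeff f"
  have n: "degree f = n" "n \<ge> 2" using assms(3) by (auto simp: n_def)
  have f0: "f \<noteq> 0" using n by auto
  then have c: "c \<noteq> 0" by (simp add: c_def)
  have "inv_q p \<ge> 0"
    using assms(5) by (cases p) (auto simp: inv_q_def one_ereal_def)
  then have a: "a \<ge> 1" unfolding a_def using n by (intro ge_one_powr_ge_zero) auto
  have b: "0 < b" "(1 + b) ^ n = 2" "real n * b \<le> 1" using root_2_bounds[of n] n by (auto simp: b_def)
  have a2\<rho>: "(a + 2) * \<rho> = real n * b" using a by (simp add: \<rho>_def)
  have \<rho>0: "0 < \<rho>" using a b n by (simp add: \<rho>_def)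
  \<comment> \<open>\<open>(a + 2) * \<rho> = n * b \<le> 1\<close>; subtracting the positive
    \<open>\<rho>\<close> makes the inequality strict.\<close>
  have \<rho>a: "\<rho> * (a + 1) < 1" using a2\<rho> b(3) \<rho>0 by (simp add: algebra_simps)
  have "\<rho> * 2 \<le> \<rho> * (a + 1)" using a \<rho>0 by (intro mult_left_mono) auto
  then have \<rho>2: "\<rho> < 1 / 2" using \<rho>a by linarith
  have bn: "(1 + (a + 2) * \<rho> / n) ^ n \<le> 2" using b(2) n by (simp add: a2\<rho>)
  have R: "R * (1 + (a - 1) * \<rho>) = \<rho> * (1 - \<rho>)"
  proof -
    have pos: "1 + (a - 1) * \<rho> > 0" using a \<rho>0 by (simp add: add_pos_nonneg)
    have a2: "a + 2 \<noteq> 0" using a by simp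
    have "R = ((a + 2) * \<rho>) * (a + 2 - (a + 2) * \<rho>) / ((a + 2) * (a + 2 + (a - 1) * ((a + 2) * \<rho>)))"
      unfolding a2\<rho> R_def by (simp add: mult_ac)
    also have "\<dots> = ((a + 2) * (a + 2) * (\<rho> * (1 - \<rho>))) / ((a + 2) * (a + 2) * (1 + (a - 1) * \<rho>))"
      by (simp add: algebra_simps)
    also have "\<dots> = \<rho> * (1 - \<rho>) / (1 + (a - 1) * \<rho>)" using a2 by simp
    finally show ?thesis using pos by simp
  qed
  have ER: "E * (1 + (a - 1) * \<rho>) \<le> \<rho> * (1 - \<rho>)" if "E \<le> R" for E
    unfolding R[symmetric] using that a \<rho>0 by (intro mult_right_mono) auto
  have Edom: "dominated n a (\<lambda>i. av (Wcorr f n x i) / dvec av n x i) (Ef av p f x)"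
    if "inj_on x {..<n}" for x
    unfolding a_def Ef_def n(1)
    using dvec_pos[OF n(2) that] n assms(5) by (intro dominated_pnorm) (auto intro: divide_nonneg_pos)
  obtain \<zeta> where \<zeta>: "f = smult c (\<Prod>i<n. [:- \<zeta> i, 1:])"
    using alg_closed_splits[OF assms(2)] by (auto simp: c_def n_def)
  have root: "root_vector f \<eta>" if "f = smult c (\<Prod>i<n. [:- \<eta> i, 1:])" for \<eta>
    unfolding root_vector_def
  proof
    fix z
    have "poly f z = c * (\<Prod>i<n. z - \<eta> i)" by (subst that) (simp add: poly_prod)
    then show "poly f z = lead_coeff f * (\<Prod>i<degree f. z - \<eta> i)" by (simp add: c_def n_def)
  qed
  have x0: "inj_on x0 {..<n}" using assms(6) by (auto simp: inj_on_def n_def)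
  have E0: "Ef av p f x0 \<le> R"
    using assms(7) by (simp add: R_def a_def b_def n_def Let_def)
  \<comment> \<open>The limit is fixed here, as the ordering of the roots localized from
    \<open>x0\<close>.\<close>
  obtain \<xi> where \<xi>: "f = smult c (\<Prod>i<n. [:- \<xi> i, 1:])"
      "dominated n a (\<lambda>i. av (x0 i - \<xi> i) / dvec av n x0 i) \<rho>"
    using root_vector_near[OF n(2) x0 c \<zeta> a \<rho>0 \<rho>a Edom[OF x0] ER[OF E0]] by blast
  note r\<xi> = root[OF \<xi>(1)]
  have step: "xs (Suc k) = Tmap f N (xs k)" for k by (simp add: xs_def)
  have inv: "inj_on (xs k) {..<n} \<and> dominated n a (\<lambda>i. av (xs k i - \<xi> i) / dvec av n (xs k) i) \<rho>" for k
  proof (induction k)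
    case 0
    then show ?case using x0 \<xi>(2) by (simp add: xs_def)
  next
    case (Suc k)
    then show ?case unfolding step using Tmap_invariant[OF n r\<xi> _ a \<rho>0 bn _ assms(4)] by blast
  qed
  then have xs: "inj_on (xs k) {..<n}"
    and dom: "dominated n a (\<lambda>i. av (xs k i - \<xi> i) / dvec av n (xs k) i) \<rho>" for k
    by auto
  \<comment> \<open>The choice \<open>\<kappa> = 1\<close> suffices for well-definedness and
    geometric convergence.\<close>
  note T = Tmap_error[OF n r\<xi> xs a \<rho>0 bn, of 1, simplified, OF dom]
  note B = contraction_factor_bounds[OF n(2) a \<rho>0 bn]
  have "inj_on \<xi> {..<n}"
    using root_vector_separation(1)[OF n(2) x0 \<rho>0 \<rho>2 \<xi>(2)] by (meson inj_onI lessThan_iff)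
  then have "rsquarefree f" by (rule rsquarefree_prod_linear[OF \<xi>(1) c])
  moreover have "xs k \<in> Dom f N" for k by (rule T(1))
  moreover have "converges_to av n xs \<xi>"
    using B T(2)[OF assms(4)[unfolded One_nat_def]]
    by (intro converges_toI[of "contraction_factor n a \<rho>"]) (auto simp: step)
  moreover have "conv_order av n xs \<xi> (N + 1)"
    by (rule Tmap_conv_order[where xs = xs, OF n r\<xi> assms(4) a \<rho>0 \<rho>2 bn xs dom step])
  moreover have "av (xs k i - \<xi> i) \<le> alpha_fun a (Ef av p f (xs k)) * av (Wcorr f n (xs k) i)"
    if E: "Ef av p f (xs k) \<le> R" and i: "i < n" for k i
  proof -
    \<comment> \<open>Localization at the iterate yields its own root-vector \<open>\<eta>\<close>,
      which uniqueness then identifies with \<open>\<xi>\<close>.\<close>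
    obtain \<eta> where \<eta>: "f = smult c (\<Prod>i<n. [:- \<eta> i, 1:])"
        "\<And>i. i < n \<Longrightarrow> av (xs k i - \<eta> i) \<le> alpha_fun a (Ef av p f (xs k)) * av (Wcorr f n (xs k) i)"
        "dominated n a (\<lambda>i. av (xs k i - \<eta> i) / dvec av n (xs k) i) \<rho>"
      using root_vector_near[OF n(2) xs c \<zeta> a \<rho>0 \<rho>a Edom[OF xs] ER[OF E]] by blast
    have "\<eta> i = \<xi> i"
      by (rule near_root_vector_unique[OF n xs f0 r\<xi> root[OF \<eta>(1)] \<rho>2 dom \<eta>(3) i])
    then show ?thesis using \<eta>(2)[OF i] by simp
  qed
  ultimately show ?thesis
    using r\<xi> unfolding Let_def n_def[symmetric] a_def[symmetric] b_def[symmetric] R_def[symmetric]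
      xs_def[abs_def, symmetric] by blast
qed

end
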